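(* Let $K\subseteq\mathbb{R}^n$ be a convex body and let $2\leqslant d\leqslant n-1$. For every $d$-dimensional linear subspace $H$ of $\mathbb{R}^n$ there exists an orthonormal basis $\{w_j\}_{j=1}^d$ of $H$ such that $$|P_{H^\perp}K|\,|K|^{d-1}\geqslant\frac{\binom{n+d}{n}}{(2n)^d}\prod_{i=1}^d|P_{w_i^\perp}K|.$$
   Context: A convex body in $\mathbb{R}^n$ is a compact convex set with non-empty interior. $|\cdot|$ denotes volume (Lebesgue measure) in the corresponding subspace. For a linear subspace $E$ of $\mathbb{R}^n$, $P_E$ denotes the orthogonal projection onto $E$, and $E^\perp$ its orthogonal complement; for a vector $w\neq0$, $w^\perp$ is the hyperplane through the origin orthogonal to $w$. *)

theory Defs
  imports "HOL-Analysis.Analysis"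
begin

definition convex_body :: "'a::euclidean_space set \<Rightarrow> bool" where
  "convex_body K \<longleftrightarrow> compact K \<and> convex K \<and> interior K \<noteq> {}"

definition orthonormal_basis :: "'a::euclidean_space set \<Rightarrow> 'a set \<Rightarrow> bool" where
  "orthonormal_basis B E \<longleftrightarrow> pairwise orthogonal B \<and> (\<forall>b\<in>B. norm b = 1) \<and> span B = E"

lemma orthonormal_basis_exists:
  assumes "subspace E"
  shows "\<exists>B. orthonormal_basis B E"
  using orthonormal_basis_subspace[OF assms] unfolding orthonormal_basis_def by metis

text \<open>Unspecified if E is not a linear subspace.\<close>

definition orth_proj :: "'a::euclidean_space set \<Rightarrow> 'a \<Rightarrow> 'a" where
  "orth_proj E x = (THE p. p \<in> E \<and> x - p \<in> orthogonal_comp E)"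

lemma orth_proj_unique_exists:
  fixes E :: "'a::euclidean_space set"
  assumes "subspace E"
  shows "\<exists>!p. p \<in> E \<and> x - p \<in> orthogonal_comp E"
proof -
  obtain p q where "p \<in> E" "\<And>w. w \<in> E \<Longrightarrow> orthogonal q w" "x = p + q"
    using orthogonal_subspace_decomp_exists[of E x] assms by (metis span_eq_iff)
  then have 1: "p \<in> E \<and> x - p \<in> orthogonal_comp E"
    by (auto simp: orthogonal_comp_def orthogonal_commute)
  have "r = p" if r: "r \<in> E \<and> x - r \<in> orthogonal_comp E" for r
  proof -
    have "r - p \<in> E" using 1 r assms by (simp add: subspace_diff)
    then have "(r - p) \<bullet> (x - p) = 0" "(r - p) \<bullet> (x - r) = 0"
      using 1 r by (auto simp: orthogonal_comp_def orthogonal_def)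
    then have "(r - p) \<bullet> (r - p) = 0" by (simp add: inner_diff_right)
    then show ?thesis by simp
  qed
  with 1 show ?thesis by blast
qed

text \<open>
  The Lebesgue measure of a linear subspace E, regarded as a measure on the ambient space:
  the product Lebesgue measure in the coordinates of an orthonormal basis of E. By rotation
  invariance it does not depend on the choice of that basis. For the standard basis of the whole
  space the formula is the library's definition of the Lebesgue measure.
\<close>

definition lebesgue_subspace :: "'a::euclidean_space set \<Rightarrow> 'a measure" where
  "lebesgue_subspace E =
     (let B = (SOME B. orthonormal_basis B E)
      in completion (distr (\<Pi>\<^sub>M b\<in>B. lborel) borel (\<lambda>f. \<Sum>b\<in>B. f b *\<^sub>R b)))"

end

theory Submission
  imports Defs
begin

text \<open>
  The inequality is Zhang's inequality for the polar projection body, localised to sections by $H$,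
  followed by a greedy choice of an orthonormal basis.

  Write $n$ for the dimension of the space, $V$ for the volume of $K$, and $h(x)$ for the norm of $x$
  times the volume of the projection of $K$ along $x$ (\<^term>\<open>proj_norm\<close> below).
  This is the support function of the projection body of $K$. Let $g(x)$ be the volume of
  $K \cap (K + x)$. The volume lost under a small translation by $x$ is $V - g(x)$, and to first order
  it is $h(x)$: slicing $K$ by the lines parallel to $x$, every chord loses exactly the length
  of $x$ as soon as $x$ is shorter than the chord. Since the loss is subadditive in $x$, the function
  $h$ is a norm. By the Brunn-Minkowski inequality the $n$-th root of $g$ is concave along rays where $g$ is positive,
  and comparing it with its tangent at the origin gives
  $g(x) \le V\,(1 - h(x)/(nV))_+^n$ (lemma \<open>covariogram_le\<close>).

  Integrate $g$ over $H$. By Fubini the integral equals the integral, over the projection of $K$ to the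
  orthogonal complement of $H$, of the squared volumes of the sections of $K$ parallel to $H$; so
  Cauchy-Schwarz bounds it below by $V^2$ divided by the volume of the projection
  (lemma \<open>measure_squared_le_projection_covariogram\<close>). In the other direction, the bound on $g$ and the
  layer-cake formula reduce the integral to the volumes of the balls $\{x \in H : h(x) \le r\}$.

  Those volumes are bounded by a box (lemma \<open>exists_basis_sublevel_le_box\<close>): let $w_1$ minimise $h$ on
  the unit sphere of $H$. Then the ball lies in the slab of half-width $r/h(w_1)$ orthogonal to $w_1$,
  and, the ball being convex and symmetric, all its sections orthogonal to $w_1$ are at most as large
  as the central one, which is the ball of $h$ on the complement of $w_1$ in $H$. Recursion gives an
  orthonormal basis for which the ball has volume at most $\prod_i 2r/h(w_i)$. A Beta integral then
  produces the binomial coefficient, and rearranging gives the claim.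

  The Brunn-Minkowski inequality itself is proved for bounded open sets by the Hadwiger-Ohmann
  argument: by hand for two boxes, then by cutting finite unions of boxes with hyperplanes, and finally
  by exhausting open sets from within.
\<close>

section \<open>Lebesgue measure in orthonormal coordinates\<close>

text \<open>
  The measure lives on the ambient space rather than on a subspace, so that different subspaces can be
  compared and combined by Fubini without changing types.
\<close>

definition coord_measure :: "'a::euclidean_space set \<Rightarrow> 'a measure" where
  "coord_measure B = distr (\<Pi>\<^sub>M b\<in>B. lborel) borel (\<lambda>f. \<Sum>b\<in>B. f b *\<^sub>R b)"

lemma sets_coord_measure [simp, measurable_cong]: "sets (coord_measure B) = sets borel"
  and space_coord_measure [simp]: "space (coord_measure B) = UNIV"
  by (simp_all add: coord_measure_def)

lemma coord_comb_measurable [measurable]: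
  "(\<lambda>f. \<Sum>b\<in>B. f b *\<^sub>R b) \<in> borel_measurable (\<Pi>\<^sub>M b\<in>B. lborel)"
  for B :: "'a::euclidean_space set"
  by measurable

lemma lborel_eq_coord_measure: "lborel = coord_measure Basis"
  unfolding coord_measure_def by (rule lborel_eq)

lemma nn_integral_coord_measure:
  fixes f :: "'a::euclidean_space \<Rightarrow> ennreal"
  assumes [measurable]: "f \<in> borel_measurable borel"
  shows "(\<integral>\<^sup>+x. f x \<partial>coord_measure B) = (\<integral>\<^sup>+g. f (\<Sum>b\<in>B. g b *\<^sub>R b) \<partial>(\<Pi>\<^sub>M b\<in>B. lborel))"
  unfolding coord_measure_def by (subst nn_integral_distr) auto

interpretation lborel_product: product_sigma_finite "\<lambda>_. lborel" ..

lemma nn_integral_coord_measure_empty: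
  assumes [measurable]: "f \<in> borel_measurable borel"
  shows "(\<integral>\<^sup>+x. f x \<partial>coord_measure ({} :: 'a::euclidean_space set)) = f 0"
  by (simp add: nn_integral_coord_measure PiM_empty nn_integral_count_space_finite)

lemma coord_comb_upd:
  fixes B :: "'a::euclidean_space set"
  assumes "finite B" "b \<notin> B"
  shows "(\<Sum>c\<in>insert b B. (g(b := s)) c *\<^sub>R c) = (\<Sum>c\<in>B. g c *\<^sub>R c) + s *\<^sub>R b"
proof -
  have "(\<Sum>c\<in>B. (g(b := s)) c *\<^sub>R c) = (\<Sum>c\<in>B. g c *\<^sub>R c)"
    using assms by (intro sum.cong) auto
  then show ?thesis using assms by (simp add: add.commute)
qed

lemma sigma_finite_PiM_lborel: "finite B \<Longrightarrow> sigma_finite_measure (\<Pi>\<^sub>M b\<in>B. (lborel :: 'b::euclidean_space measure))"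
  by (rule lborel_product.sigma_finite)

lemma nn_integral_coord_measure_swap:
  fixes f :: "'a::euclidean_space \<Rightarrow> 'b \<Rightarrow> ennreal"
  assumes "finite B" and N: "sigma_finite_measure N"
    and [measurable]: "case_prod f \<in> borel_measurable (borel \<Otimes>\<^sub>M N)"
  shows "(\<integral>\<^sup>+x. (\<integral>\<^sup>+y. f x y \<partial>N) \<partial>coord_measure B) = (\<integral>\<^sup>+y. (\<integral>\<^sup>+x. f x y \<partial>coord_measure B) \<partial>N)"
proof -
  interpret N: sigma_finite_measure N by fact
  interpret B: sigma_finite_measure "\<Pi>\<^sub>M b\<in>B. (lborel :: real measure)"
    using assms(1) by (rule sigma_finite_PiM_lborel)
  interpret pair_sigma_finite "\<Pi>\<^sub>M b\<in>B. (lborel :: real measure)" N ..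
  have "(\<integral>\<^sup>+x. (\<integral>\<^sup>+y. f x y \<partial>N) \<partial>coord_measure B)
      = (\<integral>\<^sup>+g. (\<integral>\<^sup>+y. f (\<Sum>b\<in>B. g b *\<^sub>R b) y \<partial>N) \<partial>(\<Pi>\<^sub>M b\<in>B. lborel))"
    by (rule nn_integral_coord_measure) measurable
  also have "\<dots> = (\<integral>\<^sup>+y. (\<integral>\<^sup>+g. f (\<Sum>b\<in>B. g b *\<^sub>R b) y \<partial>(\<Pi>\<^sub>M b\<in>B. lborel)) \<partial>N)"
    by (rule Fubini'[symmetric]) measurable
  also have "\<dots> = (\<integral>\<^sup>+y. (\<integral>\<^sup>+x. f x y \<partial>coord_measure B) \<partial>N)"
    by (intro nn_integral_cong nn_integral_coord_measure[symmetric]) measurable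
  finally show ?thesis .
qed

lemma nn_integral_coord_measure_measurable:
  fixes f :: "'b \<Rightarrow> 'a::euclidean_space \<Rightarrow> ennreal"
  assumes "finite B"
    and [measurable]: "case_prod f \<in> borel_measurable (N \<Otimes>\<^sub>M borel)"
  shows "(\<lambda>y. \<integral>\<^sup>+x. f y x \<partial>coord_measure B) \<in> borel_measurable N"
proof -
  interpret B: sigma_finite_measure "\<Pi>\<^sub>M b\<in>B. (lborel :: real measure)"
    using assms(1) by (rule sigma_finite_PiM_lborel)
  have "(\<lambda>y. \<integral>\<^sup>+g. f y (\<Sum>b\<in>B. g b *\<^sub>R b) \<partial>(\<Pi>\<^sub>M b\<in>B. lborel)) \<in> borel_measurable N"
    by measurable
  moreover have "(\<integral>\<^sup>+x. f y x \<partial>coord_measure B) = (\<integral>\<^sup>+g. f y (\<Sum>b\<in>B. g b *\<^sub>R b) \<partial>(\<Pi>\<^sub>M b\<in>B. lborel))"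
    if "y \<in> space N" for y
    using that by (intro nn_integral_coord_measure) measurable
  ultimately show ?thesis by (simp cong: measurable_cong)
qed

lemma nn_integral_coord_measure_insert:
  fixes B :: "'a::euclidean_space set"
  assumes "finite B" "b \<notin> B" and [measurable]: "f \<in> borel_measurable borel"
  shows "(\<integral>\<^sup>+x. f x \<partial>coord_measure (insert b B))
       = (\<integral>\<^sup>+x. (\<integral>\<^sup>+s. f (x + s *\<^sub>R b) \<partial>lborel) \<partial>coord_measure B)"
proof -
  have "(\<integral>\<^sup>+x. f x \<partial>coord_measure (insert b B))
      = (\<integral>\<^sup>+g. (\<integral>\<^sup>+s. f (\<Sum>c\<in>insert b B. (g(b := s)) c *\<^sub>R c) \<partial>lborel) \<partial>(\<Pi>\<^sub>M b\<in>B. lborel))"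
    using assms by (simp add: nn_integral_coord_measure lborel_product.product_nn_integral_insert)
  also have "\<dots> = (\<integral>\<^sup>+g. (\<integral>\<^sup>+s. f ((\<Sum>c\<in>B. g c *\<^sub>R c) + s *\<^sub>R b) \<partial>lborel) \<partial>(\<Pi>\<^sub>M b\<in>B. lborel))"
    by (intro nn_integral_cong) (simp add: coord_comb_upd[OF assms(1,2), simplified] assms(1,2))
  also have "\<dots> = (\<integral>\<^sup>+x. (\<integral>\<^sup>+s. f (x + s *\<^sub>R b) \<partial>lborel) \<partial>coord_measure B)"
    by (rule nn_integral_coord_measure[symmetric]) measurable
  finally show ?thesis .
qed

lemma nn_integral_coord_measure_union:
  fixes B :: "'a::euclidean_space set"
  assumes "finite C" "finite B" "B \<inter> C = {}" "f \<in> borel_measurable borel"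
  shows "(\<integral>\<^sup>+x. f x \<partial>coord_measure (B \<union> C))
       = (\<integral>\<^sup>+x. (\<integral>\<^sup>+y. f (x + y) \<partial>coord_measure C) \<partial>coord_measure B)"
  using assms(1,3,4)
proof (induction C arbitrary: f)
  case empty
  note [measurable] = empty
  have "(\<integral>\<^sup>+x. (\<integral>\<^sup>+y. f (x + y) \<partial>coord_measure {}) \<partial>coord_measure B) = (\<integral>\<^sup>+x. f x \<partial>coord_measure B)"
    by (subst nn_integral_coord_measure_empty) auto
  then show ?case by simp
next
  case (insert c C)
  note [measurable] = insert.prems(2)
  have "(\<integral>\<^sup>+x. f x \<partial>coord_measure (B \<union> insert c C))
      = (\<integral>\<^sup>+x. (\<integral>\<^sup>+s. f (x + s *\<^sub>R c) \<partial>lborel) \<partial>coord_measure (B \<union> C))"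
    using insert assms(2) by (subst Un_insert_right, subst nn_integral_coord_measure_insert) auto
  also have "\<dots> = (\<integral>\<^sup>+x. (\<integral>\<^sup>+y. (\<integral>\<^sup>+s. f ((x + y) + s *\<^sub>R c) \<partial>lborel) \<partial>coord_measure C) \<partial>coord_measure B)"
    using insert by (subst insert.IH) auto
  also have "\<dots> = (\<integral>\<^sup>+x. (\<integral>\<^sup>+y. f (x + y) \<partial>coord_measure (insert c C)) \<partial>coord_measure B)"
    using insert by (subst nn_integral_coord_measure_insert) (auto simp: add.assoc)
  finally show ?case .
qed

text \<open>
  Adding one vector at a time reduces the claim to the substitution $s \mapsto k - s$ on the real line.
\<close>

lemma nn_integral_coord_measure_reflect:
  fixes B :: "'a::euclidean_space set"
  assumes "finite B" "z \<in> span B" "f \<in> borel_measurable borel"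
  shows "(\<integral>\<^sup>+x. f (z - x) \<partial>coord_measure B) = (\<integral>\<^sup>+x. f x \<partial>coord_measure B)"
  using assms
proof (induction B arbitrary: f z)
  case empty
  note [measurable] = empty(2)
  show ?case using empty by (simp add: nn_integral_coord_measure_empty)
next
  case (insert b B)
  note [measurable] = insert.prems(2)
  from insert.prems(1) obtain k where k: "z - k *\<^sub>R b \<in> span B"
    unfolding span_insert by blast
  have "(\<integral>\<^sup>+x. f (z - x) \<partial>coord_measure (insert b B))
      = (\<integral>\<^sup>+x. (\<integral>\<^sup>+s. f (z - (x + s *\<^sub>R b)) \<partial>lborel) \<partial>coord_measure B)"
    using insert by (intro nn_integral_coord_measure_insert) auto
  also have "\<dots> = (\<integral>\<^sup>+x. (\<integral>\<^sup>+s. f (((z - k *\<^sub>R b) - x) + s *\<^sub>R b) \<partial>lborel) \<partial>coord_measure B)"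
  proof (rule nn_integral_cong)
    fix x
    show "(\<integral>\<^sup>+s. f (z - (x + s *\<^sub>R b)) \<partial>lborel) = (\<integral>\<^sup>+s. f (((z - k *\<^sub>R b) - x) + s *\<^sub>R b) \<partial>lborel)"
      by (subst nn_integral_real_affine[where c="-1" and t=k]) (auto simp: algebra_simps)
  qed
  also have "\<dots> = (\<integral>\<^sup>+x. (\<integral>\<^sup>+s. f (x + s *\<^sub>R b) \<partial>lborel) \<partial>coord_measure B)"
    by (rule insert.IH[OF k, where f = "\<lambda>x. \<integral>\<^sup>+s. f (x + s *\<^sub>R b) \<partial>lborel"]) measurable
  also have "\<dots> = (\<integral>\<^sup>+x. f x \<partial>coord_measure (insert b B))"
    using insert by (intro nn_integral_coord_measure_insert[symmetric]) auto
  finally show ?case .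
qed

lemma nn_integral_coord_measure_image:
  fixes B :: "'a::euclidean_space set" and T :: "'a \<Rightarrow> 'b::euclidean_space"
  assumes "finite B" "linear T" "inj_on T B" "f \<in> borel_measurable borel"
  shows "(\<integral>\<^sup>+x. f x \<partial>coord_measure (T ` B)) = (\<integral>\<^sup>+x. f (T x) \<partial>coord_measure B)"
  using assms(1,3,4)
proof (induction B arbitrary: f)
  case empty
  have [measurable]: "T \<in> borel_measurable borel"
    using assms(2) by (intro borel_measurable_continuous_onI linear_continuous_on linear_conv_bounded_linear[THEN iffD1])
  show ?case using empty assms(2)
    by (simp add: nn_integral_coord_measure_empty linear_0)
next
  case (insert b B)
  note [measurable] = insert.prems(2)
  have T[measurable]: "T \<in> borel_measurable borel"
    using assms(2) by (intro borel_measurable_continuous_onI linear_continuous_on linear_conv_bounded_linear[THEN iffD1])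
  have "(\<integral>\<^sup>+x. f x \<partial>coord_measure (T ` insert b B))
      = (\<integral>\<^sup>+x. (\<integral>\<^sup>+s. f (x + s *\<^sub>R T b) \<partial>lborel) \<partial>coord_measure (T ` B))"
    using insert by (subst image_insert, subst nn_integral_coord_measure_insert) auto
  also have "\<dots> = (\<integral>\<^sup>+x. (\<integral>\<^sup>+s. f (T x + s *\<^sub>R T b) \<partial>lborel) \<partial>coord_measure B)"
    using insert by (subst insert.IH) auto
  also have "\<dots> = (\<integral>\<^sup>+x. f (T x) \<partial>coord_measure (insert b B))"
    using insert assms(2) by (subst nn_integral_coord_measure_insert) (auto simp: linear_add linear_scale)
  finally show ?case .
qed

lemma AE_coord_measure_span:
  fixes B :: "'a::euclidean_space set"
  assumes "finite B"
  shows "AE x in coord_measure B. x \<in> span B"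
proof -
  have "closed (span B)" by (simp add: closed_subspace)
  then have [measurable]: "span B \<in> sets borel" by auto
  have "(\<Sum>b\<in>B. g b *\<^sub>R b) \<in> span B" for g
    by (intro span_sum span_scale span_base)
  then show ?thesis
    unfolding coord_measure_def by (subst AE_distr_iff) auto
qed

lemma nn_integral_lborel_reflect:
  fixes f :: "'a::euclidean_space \<Rightarrow> ennreal"
  assumes "f \<in> borel_measurable borel"
  shows "(\<integral>\<^sup>+x. f (z - x) \<partial>lborel) = (\<integral>\<^sup>+x. f x \<partial>lborel)"
  using assms nn_integral_coord_measure_reflect[of Basis z f]
  by (simp add: lborel_eq_coord_measure)

lemma nn_integral_lborel_translate:
  fixes f :: "'a::euclidean_space \<Rightarrow> ennreal"
  assumes [measurable]: "f \<in> borel_measurable borel"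
  shows "(\<integral>\<^sup>+x. f (x + z) \<partial>lborel) = (\<integral>\<^sup>+x. f x \<partial>lborel)"
  using nn_integral_lborel_reflect[of f z] nn_integral_lborel_reflect[of "\<lambda>x. f (z - x)" 0]
  by (simp add: add.commute)

text \<open>
  Both sides are translation-invariant measures, so they are proportional, and they agree on the unit
  ball. The proof is the usual one for uniqueness of Haar measure: integrate $1_U(y) f(Tx + y)$ over
  all $x$ and $y$ in both orders, with $U$ the unit ball, which is symmetric and invariant under \<^term>\<open>T\<close>.
\<close>

lemma nn_integral_lborel_orthogonal:
  fixes T :: "'a::euclidean_space \<Rightarrow> 'a"
  assumes T: "orthogonal_transformation T" and [measurable]: "f \<in> borel_measurable borel"
  shows "(\<integral>\<^sup>+x. f (T x) \<partial>lborel) = (\<integral>\<^sup>+x. f x \<partial>lborel)"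
proof -
  define S where "S = inv T"
  have lin: "linear T" and "bij T"
    using T by (auto simp: orthogonal_transformation_linear orthogonal_transformation_bij)
  then have TS: "T (S y) = y" for y by (simp add: S_def bij_is_surj surj_f_inv_f)
  have [measurable]: "T \<in> borel_measurable borel"
    using lin by (intro borel_measurable_continuous_onI linear_continuous_on linear_conv_bounded_linear[THEN iffD1])
  define U where "U = ball (0::'a) 1"
  have [measurable]: "U \<in> sets borel" by (simp add: U_def)
  have UT: "indicator U (T x) = (indicator U x :: ennreal)" for x
    using T by (simp add: U_def indicator_def orthogonal_transformation_norm)
  have "emeasure lborel U * (\<integral>\<^sup>+x. f (T x) \<partial>lborel)
      = (\<integral>\<^sup>+y. indicator U y * (\<integral>\<^sup>+x. f (T x) \<partial>lborel) \<partial>lborel)"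
    by (subst nn_integral_multc) auto
  also have "\<dots> = (\<integral>\<^sup>+y. indicator U y * (\<integral>\<^sup>+x. f (T x + y) \<partial>lborel) \<partial>lborel)"
  proof (rule nn_integral_cong)
    fix y
    have "(\<integral>\<^sup>+x. f (T (x + S y)) \<partial>lborel) = (\<integral>\<^sup>+x. f (T x) \<partial>lborel)"
      by (rule nn_integral_lborel_translate[where f="\<lambda>x. f (T x)"]) measurable
    then show "indicator U y * (\<integral>\<^sup>+x. f (T x) \<partial>lborel) = indicator U y * (\<integral>\<^sup>+x. f (T x + y) \<partial>lborel)"
      using lin by (simp add: linear_add TS)
  qed
  also have "\<dots> = (\<integral>\<^sup>+y. (\<integral>\<^sup>+x. indicator U y * f (T x + y) \<partial>lborel) \<partial>lborel)"
    by (intro nn_integral_cong nn_integral_cmult[symmetric]) measurable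
  also have "\<dots> = (\<integral>\<^sup>+x. (\<integral>\<^sup>+y. indicator U y * f (T x + y) \<partial>lborel) \<partial>lborel)"
    by (rule lborel_pair.Fubini'[symmetric]) measurable
  also have "\<dots> = (\<integral>\<^sup>+x. (\<integral>\<^sup>+y. indicator U (y - T x) * f y \<partial>lborel) \<partial>lborel)"
  proof (rule nn_integral_cong)
    fix x
    have "(\<integral>\<^sup>+y. indicator U ((y + T x) - T x) * f (y + T x) \<partial>lborel) = (\<integral>\<^sup>+y. indicator U (y - T x) * f y \<partial>lborel)"
      by (rule nn_integral_lborel_translate[where f="\<lambda>y. indicator U (y - T x) * f y"]) measurable
    then show "(\<integral>\<^sup>+y. indicator U y * f (T x + y) \<partial>lborel) = (\<integral>\<^sup>+y. indicator U (y - T x) * f y \<partial>lborel)"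
      by (simp add: add.commute)
  qed
  also have "\<dots> = (\<integral>\<^sup>+y. (\<integral>\<^sup>+x. indicator U (y - T x) * f y \<partial>lborel) \<partial>lborel)"
    by (rule lborel_pair.Fubini'[symmetric]) measurable
  also have "\<dots> = (\<integral>\<^sup>+y. (\<integral>\<^sup>+x. indicator U (y - T x) \<partial>lborel) * f y \<partial>lborel)"
    by (intro nn_integral_cong nn_integral_multc) measurable
  also have "\<dots> = (\<integral>\<^sup>+y. emeasure lborel U * f y \<partial>lborel)"
  proof (rule nn_integral_cong)
    fix y
    have "(\<integral>\<^sup>+x. indicator U (T (S y - x)) \<partial>lborel) = (\<integral>\<^sup>+x. indicator U (T x) \<partial>lborel)"
      by (rule nn_integral_lborel_reflect[where f="\<lambda>x. indicator U (T x)"]) measurable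
    then show "(\<integral>\<^sup>+x. indicator U (y - T x) \<partial>lborel) * f y = emeasure lborel U * f y"
      using lin by (simp add: linear_diff TS UT)
  qed
  also have "\<dots> = emeasure lborel U * (\<integral>\<^sup>+x. f x \<partial>lborel)"
    by (rule nn_integral_cmult) measurable
  finally have eq: "emeasure lborel U * (\<integral>\<^sup>+x. f (T x) \<partial>lborel) = emeasure lborel U * (\<integral>\<^sup>+x. f x \<partial>lborel)" .
  have "emeasure lborel U \<noteq> 0"
    using open_not_negligible[of U] by (auto simp: U_def negligible_iff_null_sets null_sets_def)
  moreover have "emeasure lborel U \<noteq> \<infinity>"
    using emeasure_bounded_finite[of U] by (auto simp: U_def)
  ultimately show ?thesis
    using eq ennreal_mult_cancel_left by fastforce
qed

lemma orthonormal_basisD: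
  assumes "orthonormal_basis B E"
  shows "finite B" "independent B" "span B = E" "dim E = card B"
    "\<And>b c. b \<in> B \<Longrightarrow> c \<in> B \<Longrightarrow> b \<bullet> c = (if b = c then 1 else 0)"
proof -
  have *: "pairwise orthogonal B" "\<And>b. b \<in> B \<Longrightarrow> norm b = 1" "span B = E"
    using assms by (auto simp: orthonormal_basis_def)
  then have "0 \<notin> B" by force
  then show "independent B" using * pairwise_orthogonal_independent by blast
  then show "finite B" using independent_imp_finite by blast
  show "span B = E" by fact
  then show "dim E = card B" using \<open>independent B\<close> dim_span_eq_card_independent by blast
  show "b \<bullet> c = (if b = c then 1 else 0)" if "b \<in> B" "c \<in> B" for b c
    using * that by (auto simp: pairwise_def orthogonal_def dot_square_norm)
qed

text \<open>
  An orthogonal map carries the standard basis to \<^term>\<open>B\<close>, and it preserves Lebesgue measure.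
\<close>

lemma coord_measure_orthonormal_basis:
  fixes B :: "'a::euclidean_space set"
  assumes B: "orthonormal_basis B UNIV"
  shows "coord_measure B = lborel"
proof -
  note * = orthonormal_basisD[OF B]
  have "card (Basis :: 'a set) = card B" using *(4) by simp
  then obtain p where p: "bij_betw p (Basis :: 'a set) B"
    using *(1) finite_same_card_bij finite_Basis by blast
  define T where "T x = (\<Sum>b\<in>Basis. (x \<bullet> b) *\<^sub>R p b)" for x :: 'a
  have pp: "p b \<bullet> p c = (if b = c then 1 else 0)" if "b \<in> Basis" "c \<in> Basis" for b c
    using that p *(5)[of "p b" "p c"] by (auto simp: bij_betw_def inj_on_def)
  have "linear T"
    unfolding T_def by (intro linearI) (auto simp: inner_add_left scaleR_left_distrib sum.distrib scaleR_sum_right)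
  moreover have "T x \<bullet> T y = x \<bullet> y" for x y
  proof -
    have "T x \<bullet> T y = (\<Sum>c\<in>Basis. \<Sum>b\<in>Basis. (y \<bullet> c) * ((x \<bullet> b) * (p b \<bullet> p c)))"
      by (simp only: T_def inner_sum_left inner_sum_right inner_scaleR_left inner_scaleR_right sum_distrib_left)
    also have "\<dots> = (\<Sum>c\<in>Basis. \<Sum>b\<in>Basis. if b = c then (x \<bullet> c) * (y \<bullet> c) else 0)"
      by (intro sum.cong refl) (auto simp: pp)
    also have "\<dots> = (\<Sum>c\<in>Basis. (x \<bullet> c) * (y \<bullet> c))" by (intro sum.cong refl) simp
    also have "\<dots> = x \<bullet> y" by (simp only: euclidean_inner[of x y])
    finally show ?thesis .
  qed
  ultimately have T: "orthogonal_transformation T" by (simp add: orthogonal_transformation_def)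
  have Tb: "T b = p b" if "b \<in> Basis" for b
  proof -
    have "T b = (\<Sum>c\<in>Basis. if c = b then p c else 0)"
      unfolding T_def using that by (intro sum.cong refl) (auto simp: inner_Basis)
    then show ?thesis using that by simp
  qed
  have TB: "T ` Basis = B" using Tb p by (auto simp: bij_betw_def)
  have inj: "inj_on T Basis" using orthogonal_transformation_inj[OF T] by (rule inj_on_subset) simp
  show ?thesis
  proof (rule measure_eqI)
    fix A assume "A \<in> sets (coord_measure B)"
    then have [measurable]: "A \<in> sets borel" by simp
    have "emeasure (coord_measure B) A = (\<integral>\<^sup>+x. indicator A x \<partial>coord_measure (T ` Basis))"
      by (simp add: TB)
    also have "\<dots> = (\<integral>\<^sup>+x. indicator A (T x) \<partial>lborel)"
      unfolding lborel_eq_coord_measure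
      using inj \<open>linear T\<close> by (intro nn_integral_coord_measure_image) auto
    also have "\<dots> = (\<integral>\<^sup>+x. indicator A x \<partial>lborel)"
      by (intro nn_integral_lborel_orthogonal T) auto
    finally show "emeasure (coord_measure B) A = emeasure lborel A" by simp
  qed simp
qed

section \<open>The Brunn-Minkowski inequality\<close>

definition brunn_minkowski :: "'a::euclidean_space set \<Rightarrow> 'a set \<Rightarrow> bool" where
  "brunn_minkowski A B \<longleftrightarrow>
     root DIM('a) (measure lborel A) + root DIM('a) (measure lborel B)
       \<le> root DIM('a) (measure lborel (A + B))"

text \<open>
  Dividing by the right-hand side, the two terms become geometric means of $p_i/(p_i+q_i)$ and
  $q_i/(p_i+q_i)$. The arithmetic means of these numbers add up to one.
\<close>

lemma root_prod_superadditive: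
  fixes p q :: "'b \<Rightarrow> real"
  assumes S: "finite S" "S \<noteq> {}" and p: "\<And>i. i \<in> S \<Longrightarrow> 0 < p i" and q: "\<And>i. i \<in> S \<Longrightarrow> 0 < q i"
  shows "root (card S) (\<Prod>i\<in>S. p i) + root (card S) (\<Prod>i\<in>S. q i) \<le> root (card S) (\<Prod>i\<in>S. p i + q i)"
proof -
  define n where "n = card S"
  have n: "n > 0" using S by (simp add: n_def card_gt_0_iff)
  have pq: "p i + q i > 0" if "i \<in> S" for i using p[OF that] q[OF that] by simp
  have *: "root n (\<Prod>i\<in>S. r i) \<le> (\<Sum>i\<in>S. r i / (p i + q i)) / n * root n (\<Prod>i\<in>S. p i + q i)"
    if r: "\<And>i. i \<in> S \<Longrightarrow> 0 < r i" for r
  proof -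
    have "root n (\<Prod>i\<in>S. r i / (p i + q i)) \<le> (\<Sum>i\<in>S. r i / (p i + q i)) / n"
    proof -
      have pos: "0 < r i / (p i + q i)" if "i \<in> S" for i
        using r pq that by simp
      then have "0 < (\<Prod>i\<in>S. r i / (p i + q i))" by (intro prod_pos) auto
      then have "root n (\<Prod>i\<in>S. r i / (p i + q i)) = (\<Prod>i\<in>S. r i / (p i + q i)) powr (1 / n)"
        using n by (intro root_powr_inverse less_imp_le)
      also have "\<dots> \<le> (\<Sum>i\<in>S. r i / (p i + q i) / n)"
        using arith_geom_mean[OF S, of "\<lambda>i. r i / (p i + q i)"] pos by (simp only: n_def less_imp_le)
      finally show ?thesis by (simp only: sum_divide_distrib)
    qed
    moreover have "(\<Prod>i\<in>S. r i / (p i + q i)) = (\<Prod>i\<in>S. r i) / (\<Prod>i\<in>S. p i + q i)"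
      by (rule prod_dividef)
    moreover have "root n (\<Prod>i\<in>S. p i + q i) > 0"
      using n pq by (intro real_root_gt_zero prod_pos) auto
    ultimately show ?thesis by (simp add: real_root_divide field_simps)
  qed
  have "(\<Sum>i\<in>S. p i / (p i + q i)) / n + (\<Sum>i\<in>S. q i / (p i + q i)) / n
      = (\<Sum>i\<in>S. (p i + q i) / (p i + q i)) / n"
    by (simp add: sum.distrib[symmetric] add_divide_distrib[symmetric])
  also have "(\<Sum>i\<in>S. (p i + q i) / (p i + q i)) = (\<Sum>i\<in>S. 1)"
    by (intro sum.cong refl) (metis pq divide_self less_irrefl)
  also have "\<dots> / n = 1" using n by (simp add: n_def)
  finally have 1: "(\<Sum>i\<in>S. p i / (p i + q i)) / n + (\<Sum>i\<in>S. q i / (p i + q i)) / n = 1" .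
  have "root n (\<Prod>i\<in>S. p i) + root n (\<Prod>i\<in>S. q i)
     \<le> ((\<Sum>i\<in>S. p i / (p i + q i)) / n + (\<Sum>i\<in>S. q i / (p i + q i)) / n) * root n (\<Prod>i\<in>S. p i + q i)"
    using *[of p] *[of q] p q by (simp add: distrib_right)
  then show ?thesis unfolding 1 by (simp add: n_def)
qed

lemma set_plus_eq_UN: "A + B = (\<Union>x\<in>A. \<Union>y\<in>B. {x + y})"
  by (auto simp: set_plus_def)

lemma open_set_plus: "open A \<Longrightarrow> open (A + B)" for A B :: "'a::real_normed_vector set"
  using open_sums[of A B] set_plus_eq_UN[of A B] by simp

lemma bounded_set_plus: "bounded A \<Longrightarrow> bounded B \<Longrightarrow> bounded (A + B)" for A B :: "'a::real_normed_vector set"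
  using bounded_sums[of A B] set_plus_eq_UN[of A B] by simp

lemma open_bounded_fmeasurable:
  "open A \<Longrightarrow> bounded A \<Longrightarrow> A \<in> fmeasurable lborel" for A :: "'a::euclidean_space set"
  using emeasure_bounded_finite[of A] by (auto intro!: fmeasurableI)

lemma measure_open_pos:
  fixes A :: "'a::euclidean_space set"
  assumes "open A" "bounded A" "A \<noteq> {}"
  shows "measure lborel A > 0"
proof -
  have "emeasure lborel A \<noteq> 0"
    using assms open_not_negligible[of A] by (auto simp: negligible_iff_null_sets null_sets_def)
  then show ?thesis
    using emeasure_bounded_finite[OF assms(2)] by (simp add: measure_def enn2real_positive_iff less_top zero_less_iff_neq_zero)
qed

text \<open>
  The sum of two boxes contains the box spanned by the sums of the corners, whose edge lengths add.
\<close>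

lemma brunn_minkowski_box:
  fixes a b c d :: "'a::euclidean_space"
  assumes "box a b \<noteq> {}" "box c d \<noteq> {}"
  shows "brunn_minkowski (box a b) (box c d)"
proof -
  have ab: "a \<bullet> i < b \<bullet> i" "c \<bullet> i < d \<bullet> i" if "i \<in> Basis" for i
    using assms that by (auto simp: box_ne_empty)
  have sub: "box (a + c) (b + d) \<subseteq> box a b + box c d"
  proof
    fix x assume x: "x \<in> box (a + c) (b + d)"
    define t where "t i = (x \<bullet> i - (a + c) \<bullet> i) / ((b + d) \<bullet> i - (a + c) \<bullet> i)" for i
    define y where "y = (\<Sum>i\<in>Basis. (a \<bullet> i + t i * (b \<bullet> i - a \<bullet> i)) *\<^sub>R i)"
    have yi: "y \<bullet> i = a \<bullet> i + t i * (b \<bullet> i - a \<bullet> i)" if "i \<in> Basis" for i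
      using that by (simp add: y_def)
    have t: "0 < t i" "t i < 1" "x \<bullet> i = (a + c) \<bullet> i + t i * ((b + d) \<bullet> i - (a + c) \<bullet> i)" if "i \<in> Basis" for i
      using x that ab[OF that] by (auto simp: t_def mem_box inner_add_left)
    have "y \<in> box a b"
      unfolding mem_box
    proof
      fix i :: 'a assume i: "i \<in> Basis"
      have "t i * (b \<bullet> i - a \<bullet> i) < 1 * (b \<bullet> i - a \<bullet> i)"
        using t[OF i] ab[OF i] by (intro mult_strict_right_mono) auto
      then have "y \<bullet> i < b \<bullet> i" unfolding yi[OF i] by (simp only: mult_1 less_diff_eq add.commute)
      moreover have "0 < t i * (b \<bullet> i - a \<bullet> i)" using t[OF i] ab[OF i] by simp
      ultimately show "a \<bullet> i < y \<bullet> i \<and> y \<bullet> i < b \<bullet> i"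
        using yi[OF i] by simp
    qed
    moreover have "x - y \<in> box c d"
      unfolding mem_box
    proof
      fix i :: 'a assume i: "i \<in> Basis"
      have "t i * (d \<bullet> i - c \<bullet> i) < 1 * (d \<bullet> i - c \<bullet> i)"
        using t[OF i] ab[OF i] by (intro mult_strict_right_mono) auto
      moreover have "0 < t i * (d \<bullet> i - c \<bullet> i)" using t[OF i] ab[OF i] by simp
      moreover have "(x - y) \<bullet> i = c \<bullet> i + t i * (d \<bullet> i - c \<bullet> i)"
        using t(3)[OF i] yi[OF i] by (simp add: inner_diff_left inner_add_left algebra_simps)
      ultimately show "c \<bullet> i < (x - y) \<bullet> i \<and> (x - y) \<bullet> i < d \<bullet> i" by simp
    qed
    ultimately show "x \<in> box a b + box c d"
      using set_plus_intro[of y "box a b" "x - y" "box c d"] by simp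
  qed
  have "root DIM('a) (measure lborel (box a b)) + root DIM('a) (measure lborel (box c d))
      \<le> root DIM('a) (measure lborel (box (a + c) (b + d)))"
  proof -
    have "measure lborel (box a b) = (\<Prod>i\<in>Basis. (b - a) \<bullet> i)" "measure lborel (box c d) = (\<Prod>i\<in>Basis. (d - c) \<bullet> i)"
      "measure lborel (box (a + c) (b + d)) = (\<Prod>i\<in>Basis. ((b + d) - (a + c)) \<bullet> i)"
      using ab by (auto intro!: measure_lborel_box simp: inner_add_left less_imp_le add_mono)
    moreover have "((b + d) - (a + c)) \<bullet> i = (b - a) \<bullet> i + (d - c) \<bullet> i" for i
      by (simp add: inner_diff_left inner_add_left)
    ultimately show ?thesis
      using root_prod_superadditive[of "Basis :: 'a set" "\<lambda>i. (b - a) \<bullet> i" "\<lambda>i. (d - c) \<bullet> i"] ab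
      by (simp add: inner_diff_left)
  qed
  also have "\<dots> \<le> root DIM('a) (measure lborel (box a b + box c d))"
    using sub
    by (intro real_root_le_mono measure_mono_fmeasurable)
       (auto intro!: open_bounded_fmeasurable open_set_plus bounded_set_plus)
  finally show ?thesis by (simp add: brunn_minkowski_def)
qed

text \<open>
  A quantitative bound on thin slabs; it makes the volume cut off by a moving hyperplane a Lipschitz
  function of the position of the hyperplane.
\<close>

lemma measure_slab_le:
  fixes B :: "'a::euclidean_space set"
  assumes B: "\<And>x i. x \<in> B \<Longrightarrow> i \<in> Basis \<Longrightarrow> \<bar>x \<bullet> i\<bar> \<le> R" and R: "0 \<le> R" and i: "i \<in> Basis" and "s \<le> t"
  shows "measure lborel (B \<inter> {x. s < x \<bullet> i \<and> x \<bullet> i \<le> t}) \<le> (2 * R) ^ (DIM('a) - 1) * (t - s)"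
proof (cases "B \<inter> {x. s < x \<bullet> i \<and> x \<bullet> i \<le> t} \<in> sets lborel")
  case True
  define l where "l = (\<Sum>j\<in>Basis. (if j = i then s else - R) *\<^sub>R j)"
  define u where "u = (\<Sum>j\<in>Basis. (if j = i then t else R) *\<^sub>R j)"
  have l: "l \<bullet> j = (if j = i then s else - R)" "u \<bullet> j = (if j = i then t else R)" if "j \<in> Basis" for j
    using that by (auto simp: l_def u_def)
  have lu: "l \<bullet> j \<le> u \<bullet> j" if "j \<in> Basis" for j using l[OF that] R \<open>s \<le> t\<close> by auto
  have "B \<inter> {x. s < x \<bullet> i \<and> x \<bullet> i \<le> t} \<subseteq> cbox l u"
    using B by (auto simp: mem_box l abs_le_iff) (smt (verit, best))+
  then have "measure lborel (B \<inter> {x. s < x \<bullet> i \<and> x \<bullet> i \<le> t}) \<le> measure lborel (cbox l u)"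
    using True by (intro measure_mono_fmeasurable) auto
  also have "\<dots> = (\<Prod>j\<in>Basis. u \<bullet> j - l \<bullet> j)"
    using lu by (simp add: measure_lborel_cbox_eq inner_diff_left)
  also have "\<dots> = (\<Prod>j\<in>insert i (Basis - {i}). u \<bullet> j - l \<bullet> j)" using i by (simp add: insert_absorb)
  also have "\<dots> = (t - s) * (\<Prod>j\<in>Basis - {i}. 2 * R)"
    using i l by (subst prod.insert) (auto intro!: prod.cong)
  also have "\<dots> = (2 * R) ^ (DIM('a) - 1) * (t - s)" using i by (simp add: mult.commute)
  finally show ?thesis .
next
  case False
  then show ?thesis using R \<open>s \<le> t\<close> by (simp add: measure_notin_sets)
qed

lemma hyperplane_cut_proportion:
  fixes B :: "'a::euclidean_space set"
  assumes B: "open B" "bounded B" and i: "i \<in> Basis" and th: "0 \<le> \<theta>" "\<theta> \<le> 1"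
  obtains c where "measure lborel (B \<inter> {x. c < x \<bullet> i}) = \<theta> * measure lborel B"
proof -
  obtain R where R: "0 < R" "\<And>x. x \<in> B \<Longrightarrow> norm x \<le> R"
    using B(2) unfolding bounded_pos by auto
  have R': "\<bar>x \<bullet> j\<bar> \<le> R" if "x \<in> B" "j \<in> Basis" for x j
    using Basis_le_norm[OF that(2), of x] R(2)[OF that(1)] by simp
  define F where "F t = measure lborel (B \<inter> {x. t < x \<bullet> i})" for t
  define L where "L = (2 * R) ^ (DIM('a) - 1)"
  have L: "L \<ge> 0" using R by (simp add: L_def)
  have halfspace: "open {x :: 'a. t < x \<bullet> i}" for t
    using open_halfspace_gt[of t i] by (simp add: inner_commute)
  have fm: "B \<inter> {x. t < x \<bullet> i} \<in> fmeasurable lborel" for t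
    using B by (intro open_bounded_fmeasurable open_Int halfspace) (auto intro: bounded_Int)
  have lip: "F s - F t \<le> L * (t - s)" "F t \<le> F s" if "s \<le> t" for s t
  proof -
    have eq: "(B \<inter> {x. s < x \<bullet> i}) - (B \<inter> {x. t < x \<bullet> i}) = B \<inter> {x. s < x \<bullet> i \<and> x \<bullet> i \<le> t}" by auto
    have "F s - F t = measure lborel (B \<inter> {x. s < x \<bullet> i \<and> x \<bullet> i \<le> t})"
      unfolding F_def eq[symmetric] using that fm
      using fmeasurableD[OF fm] by (subst measurable_measure_Diff) auto
    then show "F s - F t \<le> L * (t - s)"
      using measure_slab_le[of B R i s t] R' R(1) i that by (simp add: L_def)
    show "F t \<le> F s" unfolding F_def using that fm fmeasurableD[OF fm]
      by (intro measure_mono_fmeasurable) auto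
  qed
  have "L-lipschitz_on UNIV F"
  proof (rule lipschitz_onI)
    fix s t :: real
    show "dist (F s) (F t) \<le> L * dist s t"
      using lip[of s t] lip[of t s] by (cases "s \<le> t") (auto simp: dist_real_def abs_if)
  qed fact
  then have "continuous_on {-(2*R)..R} F"
    using lipschitz_on_continuous_on continuous_on_subset by blast
  moreover have "B \<inter> {x. - (2 * R) < x \<bullet> i} = B" "B \<inter> {x. R < x \<bullet> i} = {}"
    using R'[OF _ i] R(1) by (fastforce simp: abs_le_iff)+
  then have "F (- (2 * R)) = measure lborel B" "F R = 0" unfolding F_def by simp_all
  ultimately have "\<exists>c. -(2*R) \<le> c \<and> c \<le> R \<and> F c = \<theta> * measure lborel B"
    using R(1) th by (intro IVT2') (auto simp: mult_left_le_one_le)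
  then show ?thesis using that by (auto simp: F_def)
qed

lemma measure_cut:
  fixes B :: "'a::euclidean_space set"
  assumes B: "open B" "bounded B" and i: "i \<in> Basis"
  shows "measure lborel B = measure lborel (B \<inter> {x. c < x \<bullet> i}) + measure lborel (B \<inter> {x. x \<bullet> i < c})"
proof -
  have o: "open {x :: 'a. c < x \<bullet> i}" "open {x :: 'a. x \<bullet> i < c}"
    using open_halfspace_gt[of c i] open_halfspace_lt[of i c] by (simp_all add: inner_commute)
  let ?P = "B \<inter> {x. c < x \<bullet> i}" and ?M = "B \<inter> {x. x \<bullet> i < c}"
  have fm: "?P \<in> fmeasurable lborel" "?M \<in> fmeasurable lborel"
    using B o by (auto intro!: open_bounded_fmeasurable intro: bounded_Int)
  have "negligible {x. x \<bullet> i = c}" using i by (rule negligible_standard_hyperplane)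
  moreover have "closed {x. x \<bullet> i = c}" using closed_hyperplane[of i c] by (simp add: inner_commute)
  ultimately have null: "{x. x \<bullet> i = c} \<in> null_sets lborel"
    by (auto simp: negligible_iff_null_sets null_sets_def)
  have "measure lborel B = measure lborel (B - {x. x \<bullet> i = c})"
    using null B by (subst measure_Diff_null_set) auto
  also have "B - {x. x \<bullet> i = c} = ?P \<union> ?M" by auto
  also have "measure lborel \<dots> = measure lborel ?P + measure lborel ?M"
    using fm by (intro measure_Union) (auto simp: fmeasurable_def)
  finally show ?thesis .
qed

text \<open>
  The Hadwiger-Ohmann step. Given a hyperplane that splits \<^term>\<open>A\<close>, a parallel one splits \<^term>\<open>B\<close> in the
  same proportion. The sums of the parts on corresponding sides lie on different sides of a third
  hyperplane, so their volumes add, and because the proportions agree the two inequalities for the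
  parts add up to the inequality for the whole.
\<close>

lemma brunn_minkowski_cut:
  fixes A B :: "'a::euclidean_space set"
  assumes A: "open A" "bounded A" and B: "open B" "bounded B" "B \<noteq> {}" and i: "i \<in> Basis"
    and ne: "A \<inter> {x. c < x \<bullet> i} \<noteq> {}" "A \<inter> {x. x \<bullet> i < c} \<noteq> {}"
    and P: "\<And>c'. B \<inter> {x. c' < x \<bullet> i} \<noteq> {} \<Longrightarrow> brunn_minkowski (A \<inter> {x. c < x \<bullet> i}) (B \<inter> {x. c' < x \<bullet> i})"
    and M: "\<And>c'. B \<inter> {x. x \<bullet> i < c'} \<noteq> {} \<Longrightarrow> brunn_minkowski (A \<inter> {x. x \<bullet> i < c}) (B \<inter> {x. x \<bullet> i < c'})"
  shows "brunn_minkowski A B"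
proof -
  let ?n = "DIM('a)" and ?m = "measure (lborel :: 'a measure)"
  have o: "open {x :: 'a. c < x \<bullet> i}" "open {x :: 'a. x \<bullet> i < c}" for c
    using open_halfspace_gt[of c i] open_halfspace_lt[of i c] by (simp_all add: inner_commute)
  let ?Ap = "A \<inter> {x. c < x \<bullet> i}" and ?Am = "A \<inter> {x. x \<bullet> i < c}"
  have Apos: "?m ?Ap > 0" "?m ?Am > 0"
    using A ne o by (auto intro!: measure_open_pos intro: bounded_Int)
  have Asum: "?m A = ?m ?Ap + ?m ?Am" using A i by (rule measure_cut)
  define \<theta> where "\<theta> = ?m ?Ap / ?m A"
  have th: "0 < \<theta>" "\<theta> < 1" "?m ?Ap = \<theta> * ?m A" "?m ?Am = (1 - \<theta>) * ?m A"
    using Apos Asum by (auto simp: \<theta>_def field_simps)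
  obtain c' where c': "?m (B \<inter> {x. c' < x \<bullet> i}) = \<theta> * ?m B"
    using hyperplane_cut_proportion[OF B(1,2) i, of \<theta>] th by auto
  let ?Bp = "B \<inter> {x. c' < x \<bullet> i}" and ?Bm = "B \<inter> {x. x \<bullet> i < c'}"
  have Bpos: "?m B > 0" using B by (rule measure_open_pos)
  have Bm: "?m ?Bm = (1 - \<theta>) * ?m B"
    using measure_cut[OF B(1,2) i, of c'] c' by (simp add: algebra_simps)
  have neB: "?Bp \<noteq> {}" "?Bm \<noteq> {}" using c' Bm th Bpos by auto
  define r where "r = root ?n (?m A) + root ?n (?m B)"
  have r: "r \<ge> 0" by (simp add: r_def)
  have pow: "t * r ^ ?n \<le> ?m (X + Y)"
    if "brunn_minkowski X Y" "?m X = t * ?m A" "?m Y = t * ?m B" "0 \<le> t" for X Y t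
  proof -
    have "root ?n t * r \<le> root ?n (?m (X + Y))"
      using that by (simp add: brunn_minkowski_def r_def real_root_mult distrib_left)
    then have "(root ?n t * r) ^ ?n \<le> root ?n (?m (X + Y)) ^ ?n"
      using r that by (intro power_mono) auto
    then show ?thesis using that by (simp add: power_mult_distrib)
  qed
  have 1: "\<theta> * r ^ ?n \<le> ?m (?Ap + ?Bp)"
    using P[OF neB(1)] th c' by (intro pow) auto
  have 2: "(1 - \<theta>) * r ^ ?n \<le> ?m (?Am + ?Bm)"
    using M[OF neB(2)] th Bm by (intro pow) auto
  have fm: "?Ap + ?Bp \<in> fmeasurable lborel" "?Am + ?Bm \<in> fmeasurable lborel"
    "A + B \<in> fmeasurable lborel"
    using A B o by (auto intro!: open_bounded_fmeasurable open_set_plus bounded_set_plus intro: bounded_Int)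
  have disj: "(?Ap + ?Bp) \<inter> (?Am + ?Bm) = {}"
  proof -
    have "x \<bullet> i > c + c'" if "x \<in> ?Ap + ?Bp" for x using that by (auto simp: set_plus_def inner_add_left)
    moreover have "x \<bullet> i < c + c'" if "x \<in> ?Am + ?Bm" for x using that by (auto simp: set_plus_def inner_add_left)
    ultimately show ?thesis by fastforce
  qed
  have "r ^ ?n \<le> ?m (?Ap + ?Bp) + ?m (?Am + ?Bm)"
    using 1 2 by (simp add: algebra_simps)
  also have "\<dots> = ?m ((?Ap + ?Bp) \<union> (?Am + ?Bm))"
    using fm disj by (intro measure_Union[symmetric]) (auto simp: fmeasurable_def)
  also have "\<dots> \<le> ?m (A + B)"
    using fm set_plus_mono2[of ?Ap A ?Bp B] set_plus_mono2[of ?Am A ?Bm B]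
    by (intro measure_mono_fmeasurable) (auto simp: fmeasurable_def)
  finally have "root ?n (r ^ ?n) \<le> root ?n (?m (A + B))" by simp
  then show ?thesis
    using r by (simp add: real_root_power_cancel brunn_minkowski_def r_def)
qed

lemma brunn_minkowski_commute: "brunn_minkowski A B \<longleftrightarrow> brunn_minkowski B A"
  by (simp add: brunn_minkowski_def add.commute)

text \<open>
  The number \<^term>\<open>k\<close> is only an upper bound for the number of boxes, because a half-space may miss
  some of them.
\<close>

definition box_union :: "nat \<Rightarrow> 'a::euclidean_space set \<Rightarrow> bool" where
  "box_union k A \<longleftrightarrow> (\<exists>\<A>. finite \<A> \<and> card \<A> \<le> k \<and> disjoint \<A> \<and> {} \<notin> \<A>
      \<and> (\<forall>U\<in>\<A>. \<exists>a b. U = box a b) \<and> A = \<Union>\<A>)"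

lemma box_union_open: "box_union k A \<Longrightarrow> open A"
  and box_union_bounded: "box_union k A \<Longrightarrow> bounded A"
  unfolding box_union_def by (force intro!: open_Union, force intro!: bounded_Union)

lemma box_Int_halfspace:
  fixes a b i :: "'a::euclidean_space"
  assumes i: "i \<in> Basis"
  shows "\<exists>a'. box a b \<inter> {x. c < x \<bullet> i} = box a' b" "\<exists>b'. box a b \<inter> {x. x \<bullet> i < c} = box a b'"
proof -
  define a' where "a' = (\<Sum>j\<in>Basis. (if j = i then max c (a \<bullet> i) else a \<bullet> j) *\<^sub>R j)"
  define b' where "b' = (\<Sum>j\<in>Basis. (if j = i then min c (b \<bullet> i) else b \<bullet> j) *\<^sub>R j)"
  have "box a b \<inter> {x. c < x \<bullet> i} = box a' b"
  proof (rule set_eqI)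
    have a': "a' \<bullet> j = (if j = i then max c (a \<bullet> i) else a \<bullet> j)" if "j \<in> Basis" for j
      using that by (simp add: a'_def)
    show "x \<in> box a b \<inter> {x. c < x \<bullet> i} \<longleftrightarrow> x \<in> box a' b" for x
      using i a' by (auto simp: mem_box split: if_splits)
  qed
  then show "\<exists>a'. box a b \<inter> {x. c < x \<bullet> i} = box a' b" ..
  have "box a b \<inter> {x. x \<bullet> i < c} = box a b'"
  proof (rule set_eqI)
    have b': "b' \<bullet> j = (if j = i then min c (b \<bullet> i) else b \<bullet> j)" if "j \<in> Basis" for j
      using that by (simp add: b'_def)
    show "x \<in> box a b \<inter> {x. x \<bullet> i < c} \<longleftrightarrow> x \<in> box a b'" for x
      using i b' by (auto simp: mem_box split: if_splits)
  qed
  then show "\<exists>b'. box a b \<inter> {x. x \<bullet> i < c} = box a b'" ..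
qed

lemma box_union_Int:
  assumes A: "finite \<A>" "card \<A> \<le> k" "disjoint \<A>"
    and H: "\<And>U. U \<in> \<A> \<Longrightarrow> \<exists>a b. U \<inter> H = box a b"
  shows "box_union k (\<Union>\<A> \<inter> H)"
  unfolding box_union_def
proof (intro exI[of _ "(\<lambda>U. U \<inter> H) ` \<A> - {{}}"] conjI)
  show "finite ((\<lambda>U. U \<inter> H) ` \<A> - {{}})" using A by simp
  have "card ((\<lambda>U. U \<inter> H) ` \<A> - {{}}) \<le> card ((\<lambda>U. U \<inter> H) ` \<A>)"
    using A by (intro card_mono) auto
  also have "\<dots> \<le> card \<A>" using A by (intro card_image_le)
  finally show "card ((\<lambda>U. U \<inter> H) ` \<A> - {{}}) \<le> k" using A by simp
  show "disjoint ((\<lambda>U. U \<inter> H) ` \<A> - {{}})"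
  proof (rule pairwiseI)
    fix X Y assume "X \<in> (\<lambda>U. U \<inter> H) ` \<A> - {{}}" "Y \<in> (\<lambda>U. U \<inter> H) ` \<A> - {{}}" "X \<noteq> Y"
    then obtain U V where UV: "U \<in> \<A>" "V \<in> \<A>" "X = U \<inter> H" "Y = V \<inter> H" by blast
    then have "U \<noteq> V" using \<open>X \<noteq> Y\<close> by blast
    then have "disjnt U V" using A(3) UV(1,2) by (rule_tac pairwiseD)
    then show "disjnt X Y" using UV(3,4) by (auto simp: disjnt_def)
  qed
  show "{} \<notin> (\<lambda>U. U \<inter> H) ` \<A> - {{}}" by simp
  show "\<forall>V\<in>(\<lambda>U. U \<inter> H) ` \<A> - {{}}. \<exists>a b. V = box a b" using H by blast
  show "\<Union>\<A> \<inter> H = \<Union>((\<lambda>U. U \<inter> H) ` \<A> - {{}})" by blast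
qed

lemma box_union_halfspace:
  assumes A: "box_union k A" and i: "i \<in> Basis"
  shows "box_union k (A \<inter> {x. c < x \<bullet> i})" "box_union k (A \<inter> {x. x \<bullet> i < c})"
proof -
  obtain \<A> where *: "finite \<A>" "card \<A> \<le> k" "disjoint \<A>" "\<forall>U\<in>\<A>. \<exists>a b. U = box a b" "A = \<Union>\<A>"
    using A unfolding box_union_def by blast
  show "box_union k (A \<inter> {x. c < x \<bullet> i})" "box_union k (A \<inter> {x. x \<bullet> i < c})"
    unfolding *(5) by (rule box_union_Int[OF *(1-3)], use *(4) box_Int_halfspace[OF i] in metis)+
qed

text \<open>
  Two disjoint boxes are separated by a coordinate hyperplane, and each side of it misses one of them.
\<close>

lemma box_union_split:
  fixes A :: "'a::euclidean_space set"
  assumes A: "box_union (Suc k) A" and "\<not> box_union k A" "k \<ge> 1"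
  obtains i c where "i \<in> Basis" "box_union k (A \<inter> {x. c < x \<bullet> i})" "box_union k (A \<inter> {x. x \<bullet> i < c})"
    "A \<inter> {x. c < x \<bullet> i} \<noteq> {}" "A \<inter> {x. x \<bullet> i < c} \<noteq> {}"
proof -
  obtain \<A> where *: "finite \<A>" "card \<A> \<le> Suc k" "disjoint \<A>" "{} \<notin> \<A>" "\<forall>U\<in>\<A>. \<exists>a b. U = box a b" "A = \<Union>\<A>"
    using A unfolding box_union_def by blast
  then have "\<not> card \<A> \<le> k" using assms(2) unfolding box_union_def by blast
  then have card: "card \<A> = Suc k" using * by simp
  then have "\<not> is_singleton \<A>" "\<A> \<noteq> {}" using assms(3) by (auto simp: is_singleton_altdef)
  then obtain U V where UV: "U \<in> \<A>" "V \<in> \<A>" "U \<noteq> V" by (metis is_singletonI' )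
  note goal = that
  have split: thesis
    if UV: "U \<in> \<A>" "V \<in> \<A>" and i: "i \<in> Basis" and U: "U \<subseteq> {x. x \<bullet> i < c}" and V: "V \<subseteq> {x. c < x \<bullet> i}" for U V i c
  proof (rule goal[OF i, of c])
    have "U \<inter> {x. c < x \<bullet> i} = {}" using subsetD[OF U] by fastforce
    then have "A \<inter> {x. c < x \<bullet> i} = \<Union>(\<A> - {U}) \<inter> {x. c < x \<bullet> i}" unfolding *(6) by blast
    moreover have "box_union k (\<Union>(\<A> - {U}) \<inter> {x. c < x \<bullet> i})"
    proof (rule box_union_Int)
      show "card (\<A> - {U}) \<le> k" using UV card by simp
      show "disjoint (\<A> - {U})" using *(3) by (rule pairwise_subset) blast
      show "\<exists>a b. W \<inter> {x. c < x \<bullet> i} = box a b" if "W \<in> \<A> - {U}" for W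
        using that *(5) box_Int_halfspace(1)[OF i] by (metis DiffD1)
    qed (use * in simp)
    ultimately show "box_union k (A \<inter> {x. c < x \<bullet> i})" by simp
    have "V \<inter> {x. x \<bullet> i < c} = {}" using subsetD[OF V] by fastforce
    then have "A \<inter> {x. x \<bullet> i < c} = \<Union>(\<A> - {V}) \<inter> {x. x \<bullet> i < c}" unfolding *(6) by blast
    moreover have "box_union k (\<Union>(\<A> - {V}) \<inter> {x. x \<bullet> i < c})"
    proof (rule box_union_Int)
      show "card (\<A> - {V}) \<le> k" using UV card by simp
      show "disjoint (\<A> - {V})" using *(3) by (rule pairwise_subset) blast
      show "\<exists>a b. W \<inter> {x. x \<bullet> i < c} = box a b" if "W \<in> \<A> - {V}" for W
        using that *(5) box_Int_halfspace(2)[OF i] by (metis DiffD1)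
    qed (use * in simp)
    ultimately show "box_union k (A \<inter> {x. x \<bullet> i < c})" by simp
    have "U \<noteq> {}" "V \<noteq> {}" using * UV by auto
    then show "A \<inter> {x. c < x \<bullet> i} \<noteq> {}" "A \<inter> {x. x \<bullet> i < c} \<noteq> {}"
      using *(6) UV U V by blast+
  qed
  obtain a b c d where abcd: "U = box a b" "V = box c d" using * UV by metis
  have ne: "U \<noteq> {}" "V \<noteq> {}" using * UV by auto
  have "U \<inter> V = {}" using *(3) UV by (auto simp: pairwise_def disjnt_def)
  then obtain i where i: "i \<in> Basis" "b \<bullet> i \<le> c \<bullet> i \<or> d \<bullet> i \<le> a \<bullet> i"
    using ne unfolding abcd disjoint_interval box_ne_empty by (metis not_less)
  show thesis
  proof (cases "b \<bullet> i \<le> c \<bullet> i")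
    case True
    show ?thesis using i True by (intro split[OF UV(1,2) i(1), of "b \<bullet> i"]) (use i True in \<open>fastforce simp: abcd mem_box\<close>)+
  next
    case False
    show ?thesis using i False by (intro split[OF UV(2,1) i(1), of "d \<bullet> i"]) (use i False in \<open>fastforce simp: abcd mem_box\<close>)+
  qed
qed

lemma box_union_pos: "box_union k A \<Longrightarrow> A \<noteq> {} \<Longrightarrow> 1 \<le> k"
  unfolding box_union_def by (cases k) auto

lemma box_union_1:
  assumes "box_union 1 X" "X \<noteq> {}"
  shows "\<exists>a b. X = box a b"
proof -
  obtain \<A> where *: "finite \<A>" "card \<A> \<le> 1" "\<forall>U\<in>\<A>. \<exists>a b. U = box a b" "X = \<Union>\<A>"
    using assms unfolding box_union_def by blast
  have "\<A> \<noteq> {}" using *(4) assms(2) by blast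
  then have "card \<A> = 1" using *(1,2) card_gt_0_iff[of \<A>] by linarith
  then obtain U where U: "\<A> = {U}" by (rule card_1_singletonE)
  show ?thesis using *(3,4) unfolding U by simp
qed

text \<open>
  Induction on the total number of boxes: cutting decreases the number on one side of the sum and does
  not increase it on the other.
\<close>

lemma brunn_minkowski_box_union:
  assumes "box_union k A" "box_union l B" "A \<noteq> {}" "B \<noteq> {}"
  shows "brunn_minkowski A B"
  using assms
proof (induction "k + l" arbitrary: k l A B rule: less_induct)
  case less
  note opn = box_union_open[OF less.prems(1)] box_union_bounded[OF less.prems(1)]
     box_union_open[OF less.prems(2)] box_union_bounded[OF less.prems(2)]
  have pos: "k \<ge> 1" "l \<ge> 1"
    using box_union_pos less.prems by blast+
  show ?case
  proof (cases "k = 1 \<and> l = 1")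
    case True
    then have "box_union 1 A" "box_union 1 B" using less.prems(1,2) by simp_all
    then obtain a b c d where "A = box a b" "B = box c d"
      using less.prems(3,4) box_union_1 by meson
    then show ?thesis using less.prems(3,4) by (simp add: brunn_minkowski_box)
  next
    case False
    then consider "k > 1" | "l > 1" using pos by linarith
    then show ?thesis
    proof cases
      case 1
      then obtain k' where k: "k = Suc k'" "k' \<ge> 1" by (cases k) auto
      show ?thesis
      proof (cases "box_union k' A")
        case True
        then show ?thesis using less.hyps[of k' l A B] less.prems k by auto
      next
        case False
        obtain i c where ic: "i \<in> Basis" "box_union k' (A \<inter> {x. c < x \<bullet> i})" "box_union k' (A \<inter> {x. x \<bullet> i < c})"
          "A \<inter> {x. c < x \<bullet> i} \<noteq> {}" "A \<inter> {x. x \<bullet> i < c} \<noteq> {}"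
          using box_union_split[OF less.prems(1)[unfolded k(1)] False k(2)] by metis
        show ?thesis
        proof (rule brunn_minkowski_cut[OF opn less.prems(4) ic(1,4,5)])
          show "brunn_minkowski (A \<inter> {x. c < x \<bullet> i}) (B \<inter> {x. c' < x \<bullet> i})"
            if "B \<inter> {x. c' < x \<bullet> i} \<noteq> {}" for c'
            using that ic box_union_halfspace(1)[OF less.prems(2) ic(1)] k(1)
            by (intro less.hyps[of k' l]) simp_all
          show "brunn_minkowski (A \<inter> {x. x \<bullet> i < c}) (B \<inter> {x. x \<bullet> i < c'})"
            if "B \<inter> {x. x \<bullet> i < c'} \<noteq> {}" for c'
            using that ic box_union_halfspace(2)[OF less.prems(2) ic(1)] k(1)
            by (intro less.hyps[of k' l]) simp_all
        qed
      qed
    next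
      case 2
      then obtain l' where l: "l = Suc l'" "l' \<ge> 1" by (cases l) auto
      show ?thesis
      proof (cases "box_union l' B")
        case True
        then show ?thesis using less.hyps[of k l' A B] less.prems l by auto
      next
        case False
        obtain i c where ic: "i \<in> Basis" "box_union l' (B \<inter> {x. c < x \<bullet> i})" "box_union l' (B \<inter> {x. x \<bullet> i < c})"
          "B \<inter> {x. c < x \<bullet> i} \<noteq> {}" "B \<inter> {x. x \<bullet> i < c} \<noteq> {}"
          using box_union_split[OF less.prems(2)[unfolded l(1)] False l(2)] by metis
        have "brunn_minkowski B A"
        proof (rule brunn_minkowski_cut[OF opn(3,4,1,2) less.prems(3) ic(1,4,5)])
          show "brunn_minkowski (B \<inter> {x. c < x \<bullet> i}) (A \<inter> {x. c' < x \<bullet> i})"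
            if "A \<inter> {x. c' < x \<bullet> i} \<noteq> {}" for c'
            using that ic box_union_halfspace(1)[OF less.prems(1) ic(1)] l(1)
            by (intro less.hyps[of l' k]) simp_all
          show "brunn_minkowski (B \<inter> {x. x \<bullet> i < c}) (A \<inter> {x. x \<bullet> i < c'})"
            if "A \<inter> {x. x \<bullet> i < c'} \<noteq> {}" for c'
            using that ic box_union_halfspace(2)[OF less.prems(1) ic(1)] l(1)
            by (intro less.hyps[of l' k]) simp_all
        qed
        then show ?thesis by (simp add: brunn_minkowski_commute)
      qed
    qed
  qed
qed

text \<open>
  An open set is a countable union of non-overlapping closed boxes; the interiors of finitely many of
  them exhaust it in measure, since the boundaries are null sets.
\<close>

lemma open_bounded_approx_box_union:
  fixes A :: "'a::euclidean_space set"
  assumes A: "open A" "bounded A" "A \<noteq> {}"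
  obtains X where "\<And>m. X m \<subseteq> A" "\<And>m. X m \<noteq> {}" "\<And>m. box_union (Suc m) (X m)"
    "(\<lambda>m. measure lborel (X m)) \<longlonglongrightarrow> measure lborel A"
proof -
  obtain a b where ab: "A \<subseteq> cbox a b" using bounded_subset_cbox_symmetric[OF A(2)] by blast
  have "interior A \<subseteq> box a b" using ab interior_mono[of A "cbox a b"] by (simp add: interior_cbox)
  then have ne: "box a b \<noteq> {}" using A by (auto simp: interior_open)
  \<comment> \<open>This gauge forces each box of the covering to lie inside \<open>A\<close>.\<close>
  have "gauge (\<lambda>x. if x \<in> A then A else UNIV)" using A(1) by (auto simp: gauge_def)
  then obtain \<D> where D: "countable \<D>" and "\<Union>\<D> \<subseteq> cbox a b"
    and D': "\<And>K. K \<in> \<D> \<Longrightarrow> interior K \<noteq> {} \<and> (\<exists>c d. K = cbox c d)"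
    and D'': "pairwise (\<lambda>A B. interior A \<inter> interior B = {}) \<D>"
    "\<And>K. K \<in> \<D> \<Longrightarrow> \<exists>x \<in> A \<inter> K. K \<subseteq> (if x \<in> A then A else UNIV)"
    "\<And>u v. cbox u v \<in> \<D> \<Longrightarrow> \<exists>n. \<forall>i \<in> Basis. v \<bullet> i - u \<bullet> i = (b \<bullet> i - a \<bullet> i) / 2^n"
    "A \<subseteq> \<Union>\<D>"
    by (rule covering_lemma[OF ab ne]) (rule that)
  note D = D D' D''(1,2,4)
  have sub: "K \<subseteq> A" if "K \<in> \<D>" for K using D(4)[OF that] by auto
  have "\<D> \<noteq> {}" using D(5) A(3) by auto
  then obtain f :: "nat \<Rightarrow> 'a set" where f: "range f = \<D>"
    using D(1) by (metis range_from_nat_into)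
  define X where "X m = (\<Union>k\<le>m. interior (f k))" for m
  have fk: "f k \<in> \<D>" for k using f by auto
  have "interior (f k) \<subseteq> A" for k using sub[OF fk[of k]] interior_subset[of "f k"] by (rule order_trans[rotated])
  then have XA: "X m \<subseteq> A" for m unfolding X_def by blast
  then have XA': "(\<Union>m. X m) \<subseteq> A" by blast
  show thesis
  proof
    show "X m \<subseteq> A" for m by (rule XA)
    show "X m \<noteq> {}" for m using conjunct1[OF D(2)[OF fk[of 0]]] by (auto simp: X_def)
    show "box_union (Suc m) (X m)" for m
      unfolding box_union_def
    proof (intro exI[of _ "(\<lambda>k. interior (f k)) ` {..m}"] conjI)
      show "finite ((\<lambda>k. interior (f k)) ` {..m})" by simp
      show "card ((\<lambda>k. interior (f k)) ` {..m}) \<le> Suc m"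
        using card_image_le[of "{..m}" "\<lambda>k. interior (f k)"] by simp
      show "disjoint ((\<lambda>k. interior (f k)) ` {..m})"
      proof (rule pairwiseI)
        fix U V assume "U \<in> (\<lambda>k. interior (f k)) ` {..m}" "V \<in> (\<lambda>k. interior (f k)) ` {..m}" "U \<noteq> V"
        then obtain k l where kl: "U = interior (f k)" "V = interior (f l)" by blast
        then have "f k \<noteq> f l" using \<open>U \<noteq> V\<close> by auto
        then show "disjnt U V" using pairwiseD[OF D(3) fk fk] kl by (auto simp: disjnt_def)
      qed
      have "interior (f k) \<noteq> {}" for k using D(2)[OF fk] by (rule conjunct1)
      then show "{} \<notin> (\<lambda>k. interior (f k)) ` {..m}" by auto
      show "\<forall>U\<in>(\<lambda>k. interior (f k)) ` {..m}. \<exists>a b. U = box a b"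
      proof (rule ballI)
        fix U assume "U \<in> (\<lambda>k. interior (f k)) ` {..m}"
        then obtain k where k: "U = interior (f k)" by blast
        obtain c d where "f k = cbox c d" using D(2)[OF fk[of k]] by (elim conjE exE)
        then have "U = box c d" using k by (simp add: interior_cbox)
        then show "\<exists>a b. U = box a b" by (intro exI)
      qed
      show "X m = \<Union> ((\<lambda>k. interior (f k)) ` {..m})" by (simp add: X_def)
    qed
    have "(\<lambda>m. measure lborel (X m)) \<longlonglongrightarrow> measure lborel (\<Union>m. X m)"
    proof (rule Lim_measure_incseq)
      show "range X \<subseteq> sets lborel" by (auto simp: X_def)
      show "incseq X" unfolding X_def by (intro monoI) force
      have "(\<Union>m. X m) \<subseteq> A" using XA by blast
      then have "bounded (\<Union>m. X m)" using A(2) bounded_subset by blast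
      then show "emeasure lborel (\<Union>m. X m) \<noteq> \<infinity>" using emeasure_bounded_finite by fastforce
    qed
    moreover have "measure lborel (\<Union>m. X m) = measure lborel A"
    proof -
      have fr: "f k \<subseteq> interior (f k) \<union> frontier (f k)" for k
        using closure_subset[of "f k"] by (auto simp: frontier_def)
      have AX: "A \<subseteq> (\<Union>m. X m) \<union> (\<Union>k. frontier (f k))"
      proof (rule subsetI)
        fix x assume "x \<in> A"
        then obtain k where "x \<in> f k" using D(5) f by blast
        moreover have "interior (f k) \<subseteq> X k" by (auto simp: X_def)
        ultimately show "x \<in> (\<Union>m. X m) \<union> (\<Union>k. frontier (f k))"
          using fr[of k] by blast
      qed
      have null: "(\<Union>k. frontier (f k)) \<in> null_sets lborel"
      proof (intro null_sets_UN)
        fix k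
        obtain c d where "f k = cbox c d" using D(2)[OF fk[of k]] by (elim conjE exE)
        then have "negligible (frontier (f k))"
          by (simp add: negligible_convex_frontier)
        then show "frontier (f k) \<in> null_sets lborel"
          by (auto simp: negligible_iff_null_sets null_sets_def)
      qed
      have "(\<Union>m. X m) \<in> sets lborel" unfolding X_def by auto
      have "measure lborel A = measure lborel (A - (\<Union>k. frontier (f k)))"
        using null A by (subst measure_Diff_null_set) auto
      also have "\<dots> = measure lborel ((\<Union>m. X m) - (\<Union>k. frontier (f k)))"
        using AX XA' by (intro arg_cong[of _ _ "measure lborel"]) blast
      also have "\<dots> = measure lborel (\<Union>m. X m)"
        using null \<open>(\<Union>m. X m) \<in> sets lborel\<close> by (subst measure_Diff_null_set) auto
      finally show ?thesis by simp
    qed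
    ultimately show "(\<lambda>m. measure lborel (X m)) \<longlonglongrightarrow> measure lborel A" by simp
  qed
qed

theorem brunn_minkowski_open:
  fixes A B :: "'a::euclidean_space set"
  assumes A: "open A" "bounded A" "A \<noteq> {}" and B: "open B" "bounded B" "B \<noteq> {}"
  shows "brunn_minkowski A B"
proof -
  let ?r = "\<lambda>x. root DIM('a) (measure lborel (x :: 'a set))"
  obtain X where X: "\<And>m. X m \<subseteq> A" "\<And>m. X m \<noteq> {}" "\<And>m. box_union (Suc m) (X m)"
    "(\<lambda>m. measure lborel (X m)) \<longlonglongrightarrow> measure lborel A"
    using open_bounded_approx_box_union[OF A] by blast
  obtain Y where Y: "\<And>m. Y m \<subseteq> B" "\<And>m. Y m \<noteq> {}" "\<And>m. box_union (Suc m) (Y m)"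
    "(\<lambda>m. measure lborel (Y m)) \<longlonglongrightarrow> measure lborel B"
    using open_bounded_approx_box_union[OF B] by blast
  have "?r (X m) + ?r (Y m) \<le> ?r (A + B)" for m
  proof -
    have "?r (X m) + ?r (Y m) \<le> ?r (X m + Y m)"
      using brunn_minkowski_box_union[OF X(3) Y(3) X(2) Y(2)] by (simp add: brunn_minkowski_def)
    also have "\<dots> \<le> ?r (A + B)"
      using set_plus_mono2[OF X(1)[of m] Y(1)[of m]] open_set_plus[OF box_union_open[OF X(3)], of m "Y m"]
        open_bounded_fmeasurable[OF open_set_plus[OF A(1)] bounded_set_plus[OF A(2) B(2)]]
      by (intro real_root_le_mono measure_mono_fmeasurable) simp_all
    finally show ?thesis .
  qed
  moreover have "(\<lambda>m. ?r (X m) + ?r (Y m)) \<longlonglongrightarrow> ?r A + ?r B"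
    by (intro tendsto_intros X Y)
  ultimately show ?thesis
    unfolding brunn_minkowski_def by (intro LIMSEQ_le_const2[of _ _ "?r (A + B)"]) auto
qed

lemma measure_interior_convex:
  fixes S :: "'a::euclidean_space set"
  assumes "convex S" "bounded S" "S \<in> sets borel"
  shows "measure lborel (interior S) = measure lborel S"
  using measure_interior[of S] negligible_convex_frontier[of S] assms by simp

lemma interior_nonempty_of_measure_pos:
  fixes S :: "'a::euclidean_space set"
  assumes "convex S" "S \<in> sets borel" "measure lborel S > 0"
  shows "interior S \<noteq> {}"
proof
  assume "interior S = {}"
  then have "negligible S" using negligible_convex_interior assms(1) by blast
  then show False using assms by (auto simp: negligible_iff_null_sets null_sets_def measure_def)
qed

lemma measure_lborel_scaleR:
  fixes S :: "'a::euclidean_space set"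
  assumes "S \<in> sets borel" "(*\<^sub>R) c ` S \<in> sets borel"
  shows "measure lborel ((*\<^sub>R) c ` S) = \<bar>c\<bar> ^ DIM('a) * measure lborel S"
  using measure_lebesgue_affine[of c 0 S] assms by (simp add: image_image)

text \<open>
  A convex set and its interior have the same measure, so the inequality for open sets applies. It is
  stated for a superset \<^term>\<open>T\<close> of the weighted sum, because the sum of two Borel sets is not always Borel.
\<close>

theorem brunn_minkowski_convex:
  fixes S S' T :: "'a::euclidean_space set"
  assumes S: "convex S" "bounded S" "S \<in> sets borel" "measure lborel S > 0"
    and S': "convex S'" "bounded S'" "S' \<in> sets borel" "measure lborel S' > 0"
    and T: "T \<in> fmeasurable lborel" and ab: "0 < a" "0 < b"
    and sub: "\<And>x y. x \<in> S \<Longrightarrow> y \<in> S' \<Longrightarrow> a *\<^sub>R x + b *\<^sub>R y \<in> T"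
  shows "a * root DIM('a) (measure lborel S) + b * root DIM('a) (measure lborel S')
     \<le> root DIM('a) (measure lborel T)"
proof -
  let ?m = "measure (lborel :: 'a measure)"
  define A where "A = (*\<^sub>R) a ` interior S"
  define B where "B = (*\<^sub>R) b ` interior S'"
  have A: "open A" "bounded A" "A \<noteq> {}"
    using ab S interior_nonempty_of_measure_pos[of S]
    by (auto simp: A_def intro!: open_scaling bounded_scaling intro: bounded_subset[OF _ interior_subset])
  have B: "open B" "bounded B" "B \<noteq> {}"
    using ab S' interior_nonempty_of_measure_pos[of S']
    by (auto simp: B_def intro!: open_scaling bounded_scaling intro: bounded_subset[OF _ interior_subset])
  have "?m A = a ^ DIM('a) * ?m S"
    using A S ab unfolding A_def by (subst measure_lborel_scaleR) (auto simp: measure_interior_convex)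
  then have rA: "root DIM('a) (?m A) = a * root DIM('a) (?m S)"
    using ab by (simp add: real_root_mult real_root_power_cancel)
  have "?m B = b ^ DIM('a) * ?m S'"
    using B S' ab unfolding B_def by (subst measure_lborel_scaleR) (auto simp: measure_interior_convex)
  then have rB: "root DIM('a) (?m B) = b * root DIM('a) (?m S')"
    using ab by (simp add: real_root_mult real_root_power_cancel)
  have "A + B \<subseteq> T"
    using sub interior_subset[of S] interior_subset[of S'] by (auto simp: A_def B_def set_plus_def)
  then have "root DIM('a) (?m (A + B)) \<le> root DIM('a) (?m T)"
    using open_set_plus[OF A(1), of B] T by (intro real_root_le_mono measure_mono_fmeasurable) simp_all
  then show ?thesis
    using brunn_minkowski_open[OF A B] unfolding brunn_minkowski_def rA rB by linarith
qed

section \<open>Orthogonal projections and measures on subspaces\<close>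

lemma orth_proj_orthonormal_basis:
  fixes B :: "'a::euclidean_space set"
  assumes B: "orthonormal_basis B E"
  shows "orth_proj E x = (\<Sum>b\<in>B. (x \<bullet> b) *\<^sub>R b)"
proof -
  note * = orthonormal_basisD[OF B]
  have E: "subspace E" unfolding *(3)[symmetric] by (rule subspace_span)
  let ?p = "\<Sum>b\<in>B. (x \<bullet> b) *\<^sub>R b"
  have 1: "?p \<in> E" unfolding *(3)[symmetric] by (intro span_sum span_scale span_base)
  have "(x - ?p) \<bullet> c = 0" if "c \<in> B" for c
  proof -
    have "?p \<bullet> c = (\<Sum>b\<in>B. if b = c then x \<bullet> b else 0)"
      unfolding inner_sum_left using *(5) that by (intro sum.cong) auto
    then show ?thesis using *(1) that by (simp add: inner_diff_left)
  qed
  then have "(x - ?p) \<bullet> y = 0" if "y \<in> E" for y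
    using orthogonal_to_span[of y B "x - ?p"] *(3) that by (auto simp: orthogonal_def)
  then have 2: "x - ?p \<in> orthogonal_comp E"
    by (auto simp: orthogonal_comp_def orthogonal_def inner_commute)
  show ?thesis
    unfolding orth_proj_def using orth_proj_unique_exists[OF E, of x] 1 2 by (intro the1_equality) auto
qed

lemma orth_proj_in:
  assumes "subspace E"
  shows "orth_proj E x \<in> E" "x - orth_proj E x \<in> orthogonal_comp E"
  using theI'[OF orth_proj_unique_exists[OF assms, of x]] by (auto simp: orth_proj_def)

lemma orth_proj_add:
  assumes "subspace E" "x \<in> E" "z \<in> orthogonal_comp E"
  shows "orth_proj E (x + z) = x"
  unfolding orth_proj_def using orth_proj_unique_exists[OF assms(1), of "x + z"] assms
  by (intro the1_equality) auto

lemma linear_orth_proj: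
  assumes "subspace E"
  shows "linear (orth_proj E)"
proof -
  obtain B where B: "orthonormal_basis B E" using orthonormal_basis_exists[OF assms] by blast
  show ?thesis
    unfolding orth_proj_orthonormal_basis[OF B]
    by (intro linearI) (auto simp: inner_add_left scaleR_left_distrib sum.distrib scaleR_sum_right)
qed

lemma orth_proj_measurable: "subspace E \<Longrightarrow> orth_proj E \<in> borel_measurable borel"
  using linear_orth_proj[of E]
  by (intro borel_measurable_continuous_onI linear_continuous_on) (simp add: linear_conv_bounded_linear)

lemma compact_orth_proj:
  assumes "subspace E" "compact K"
  shows "compact (orth_proj E ` K)"
  using linear_orth_proj[OF assms(1)] assms(2)
  by (intro compact_continuous_image linear_continuous_on) (simp_all add: linear_conv_bounded_linear)

lemma orthonormal_basis_union:
  fixes B C :: "'a::euclidean_space set"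
  assumes B: "orthonormal_basis B E" and C: "orthonormal_basis C (orthogonal_comp E)"
  shows "orthonormal_basis (B \<union> C) UNIV" "B \<inter> C = {}"
proof -
  note b = orthonormal_basisD[OF B] and c = orthonormal_basisD[OF C]
  have E: "subspace E" unfolding b(3)[symmetric] by (rule subspace_span)
  have orth: "orthogonal x y" if "x \<in> B" "y \<in> C" for x y
  proof -
    have "x \<in> E" "y \<in> orthogonal_comp E" using that b(3) c(3) span_base by blast+
    then show ?thesis by (auto simp: orthogonal_comp_def)
  qed
  have nz: "norm x = 1" if "x \<in> B \<union> C" for x using that B C by (auto simp: orthonormal_basis_def)
  show "B \<inter> C = {}"
  proof (rule ccontr)
    assume "B \<inter> C \<noteq> {}"
    then obtain x where "x \<in> B" "x \<in> C" by auto
    then show False using orth[of x x] nz[of x] by (auto simp: orthogonal_self)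
  qed
  have "pairwise orthogonal (B \<union> C)"
    using B C orth orthogonal_commute unfolding orthonormal_basis_def pairwise_def by blast
  moreover have "span (B \<union> C) = UNIV"
  proof -
    have "x \<in> span (B \<union> C)" for x
    proof -
      have "orth_proj E x \<in> span (B \<union> C)" "x - orth_proj E x \<in> span (B \<union> C)"
        using orth_proj_in[OF E, of x] b(3) c(3) span_mono[of B "B \<union> C"] span_mono[of C "B \<union> C"] by auto
      then have "orth_proj E x + (x - orth_proj E x) \<in> span (B \<union> C)" by (rule span_add)
      then show ?thesis by simp
    qed
    then show ?thesis by auto
  qed
  ultimately show "orthonormal_basis (B \<union> C) UNIV" using nz by (simp add: orthonormal_basis_def)
qed

lemma nn_integral_lborel_orthonormal_split:
  fixes B C :: "'a::euclidean_space set"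
  assumes B: "orthonormal_basis B E" and C: "orthonormal_basis C (orthogonal_comp E)"
    and f: "f \<in> borel_measurable borel"
  shows "(\<integral>\<^sup>+x. f x \<partial>lborel) = (\<integral>\<^sup>+x. (\<integral>\<^sup>+y. f (x + y) \<partial>coord_measure C) \<partial>coord_measure B)"
    "(\<integral>\<^sup>+x. f x \<partial>lborel) = (\<integral>\<^sup>+y. (\<integral>\<^sup>+x. f (x + y) \<partial>coord_measure B) \<partial>coord_measure C)"
proof -
  note U = orthonormal_basis_union[OF B C]
  note fin = orthonormal_basisD(1)[OF B] orthonormal_basisD(1)[OF C]
  have eq: "coord_measure (B \<union> C) = lborel" by (rule coord_measure_orthonormal_basis[OF U(1)])
  show "(\<integral>\<^sup>+x. f x \<partial>lborel) = (\<integral>\<^sup>+x. (\<integral>\<^sup>+y. f (x + y) \<partial>coord_measure C) \<partial>coord_measure B)"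
    unfolding eq[symmetric] by (rule nn_integral_coord_measure_union) (use fin U f in auto)
  have "(\<integral>\<^sup>+x. f x \<partial>lborel) = (\<integral>\<^sup>+y. (\<integral>\<^sup>+x. f (y + x) \<partial>coord_measure B) \<partial>coord_measure C)"
    unfolding eq[symmetric] Un_commute[of B C]
    by (rule nn_integral_coord_measure_union) (use fin U f in auto)
  then show "(\<integral>\<^sup>+x. f x \<partial>lborel) = (\<integral>\<^sup>+y. (\<integral>\<^sup>+x. f (x + y) \<partial>coord_measure B) \<partial>coord_measure C)"
    by (simp add: add.commute)
qed

lemma emeasure_coord_measure_cube:
  fixes C :: "'a::euclidean_space set"
  assumes C: "orthonormal_basis C E"
  shows "emeasure (coord_measure C) {z. \<forall>c\<in>C. \<bar>z \<bullet> c\<bar> \<le> 1} = 2 ^ card C"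
proof -
  note c = orthonormal_basisD[OF C]
  have [measurable]: "finite C" by fact
  have m: "{z. \<forall>c\<in>C. \<bar>z \<bullet> c\<bar> \<le> 1} \<in> sets borel" by measurable
  have "(\<Sum>b\<in>C. f b *\<^sub>R b) \<bullet> d = f d" if "d \<in> C" for f d
  proof -
    have "(\<Sum>b\<in>C. f b *\<^sub>R b) \<bullet> d = (\<Sum>b\<in>C. if b = d then f b else 0)"
      unfolding inner_sum_left using c(5) that by (intro sum.cong) auto
    then show ?thesis using c(1) that by simp
  qed
  then have "(\<lambda>f. \<Sum>b\<in>C. f b *\<^sub>R b) -` {z. \<forall>c\<in>C. \<bar>z \<bullet> c\<bar> \<le> 1} \<inter> space (\<Pi>\<^sub>M b\<in>C. lborel)
     = (\<Pi>\<^sub>E b\<in>C. {-1..1::real})"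
    by (auto simp: space_PiM PiE_iff abs_le_iff)
  then have "emeasure (coord_measure C) {z. \<forall>c\<in>C. \<bar>z \<bullet> c\<bar> \<le> 1}
      = emeasure (\<Pi>\<^sub>M b\<in>C. lborel) (\<Pi>\<^sub>E b\<in>C. {-1..1::real})"
    unfolding coord_measure_def using m by (subst emeasure_distr) auto
  also have "\<dots> = (\<Prod>b\<in>C. emeasure lborel {-1..1::real})"
    using c(1) by (intro lborel_product.emeasure_PiM) auto
  also have "\<dots> = 2 ^ card C" by simp
  finally show ?thesis .
qed

text \<open>
  The product of a set in the subspace \<^term>\<open>E\<close> with a cube in its orthogonal complement, where \<^term>\<open>C\<close> is
  meant to be an orthonormal basis of that complement. Statements about lower-dimensional volume become
  statements about \<^const>\<open>lborel\<close>; in particular Brunn-Minkowski in subspaces follows from the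
  full-dimensional inequality.
\<close>

definition thicken :: "'a::euclidean_space set \<Rightarrow> 'a set \<Rightarrow> 'a set \<Rightarrow> 'a set" where
  "thicken E C A = {x. orth_proj E x \<in> A \<and> (\<forall>c\<in>C. \<bar>x \<bullet> c\<bar> \<le> 1)}"

lemma thicken_measurable:
  assumes "subspace E" "orthonormal_basis C (orthogonal_comp E)" "A \<in> sets borel"
  shows "thicken E C A \<in> sets borel"
proof -
  have [measurable]: "orth_proj E \<in> borel_measurable borel" "finite C" "A \<in> sets borel"
    using assms orth_proj_measurable orthonormal_basisD(1) by blast+
  show ?thesis unfolding thicken_def by measurable
qed

lemma emeasure_thicken:
  fixes B C :: "'a::euclidean_space set"
  assumes B: "orthonormal_basis B E" and C: "orthonormal_basis C (orthogonal_comp E)"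
    and A[measurable]: "A \<in> sets borel"
  shows "emeasure lborel (thicken E C A) = emeasure (coord_measure B) A * 2 ^ card C"
proof -
  note b = orthonormal_basisD[OF B] and c = orthonormal_basisD[OF C]
  have E: "subspace E" unfolding b(3)[symmetric] by (rule subspace_span)
  have [measurable]: "orth_proj E \<in> borel_measurable borel" "finite C"
    using E orth_proj_measurable c(1) by blast+
  have [measurable]: "thicken E C A \<in> sets borel" by (rule thicken_measurable[OF E C A])
  have "emeasure lborel (thicken E C A) = (\<integral>\<^sup>+x. indicator (thicken E C A) x \<partial>lborel)" by simp
  also have "\<dots> = (\<integral>\<^sup>+x. (\<integral>\<^sup>+y. indicator (thicken E C A) (x + y) \<partial>coord_measure C) \<partial>coord_measure B)"
    by (rule nn_integral_lborel_orthonormal_split(1)[OF B C]) measurable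
  also have "\<dots> = (\<integral>\<^sup>+x. (\<integral>\<^sup>+y. indicator A x * indicator {z. \<forall>c\<in>C. \<bar>z \<bullet> c\<bar> \<le> 1} y \<partial>coord_measure C) \<partial>coord_measure B)"
  proof (rule nn_integral_cong_AE, use AE_coord_measure_span[OF b(1)] in eventually_elim)
    fix x assume "x \<in> span B"
    then have x: "x \<in> E" by (simp add: b(3))
    show "(\<integral>\<^sup>+y. indicator (thicken E C A) (x + y) \<partial>coord_measure C)
        = (\<integral>\<^sup>+y. indicator A x * indicator {z. \<forall>c\<in>C. \<bar>z \<bullet> c\<bar> \<le> 1} y \<partial>coord_measure C)"
    proof (rule nn_integral_cong_AE, use AE_coord_measure_span[OF c(1)] in eventually_elim)
      fix y assume "y \<in> span C"
      then have y: "y \<in> orthogonal_comp E" by (simp add: c(3))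
      have "x \<bullet> d = 0" if "d \<in> C" for d
      proof -
        have "d \<in> orthogonal_comp E" using that c(3) span_base by blast
        then show ?thesis using x by (auto simp: orthogonal_comp_def orthogonal_def)
      qed
      then show "indicator (thicken E C A) (x + y) = (indicator A x * indicator {z. \<forall>c\<in>C. \<bar>z \<bullet> c\<bar> \<le> 1} y :: ennreal)"
        using orth_proj_add[OF E x y] by (auto simp: thicken_def indicator_def inner_add_left)
    qed
  qed
  also have "\<dots> = (\<integral>\<^sup>+x. indicator A x * emeasure (coord_measure C) {z. \<forall>c\<in>C. \<bar>z \<bullet> c\<bar> \<le> 1} \<partial>coord_measure B)"
    by (intro nn_integral_cong) (subst nn_integral_cmult, auto)
  also have "\<dots> = emeasure (coord_measure B) A * 2 ^ card C"
    by (subst nn_integral_multc) (auto simp: emeasure_coord_measure_cube[OF C])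
  finally show ?thesis .
qed

lemma bounded_thicken:
  fixes C :: "'a::euclidean_space set"
  assumes E: "subspace E" and C: "orthonormal_basis C (orthogonal_comp E)" and A: "bounded A"
  shows "bounded (thicken E C A)"
proof -
  obtain B where B: "orthonormal_basis B E" using orthonormal_basis_exists[OF E] by blast
  obtain R where R: "\<And>x. x \<in> A \<Longrightarrow> norm x \<le> R" using A unfolding bounded_iff by blast
  note U = orthonormal_basis_union[OF B C]
  note fin = orthonormal_basisD(1)[OF B] orthonormal_basisD(1)[OF C]
  have "norm x \<le> R + card C" if "x \<in> thicken E C A" for x
  proof -
    have "x \<in> UNIV" "subspace (UNIV :: 'a set)" by auto
    then have "orth_proj UNIV x = x" using orth_proj_add[of UNIV x 0] by (simp add: orthogonal_comp_def orthogonal_def)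
    then have "x = (\<Sum>b\<in>B \<union> C. (x \<bullet> b) *\<^sub>R b)" using orth_proj_orthonormal_basis[OF U(1), of x] by simp
    also have "\<dots> = orth_proj E x + (\<Sum>b\<in>C. (x \<bullet> b) *\<^sub>R b)"
      using fin U(2) by (simp add: sum.union_disjoint orth_proj_orthonormal_basis[OF B])
    finally have "norm x \<le> norm (orth_proj E x) + norm (\<Sum>b\<in>C. (x \<bullet> b) *\<^sub>R b)" by (metis norm_triangle_ineq)
    also have "norm (\<Sum>b\<in>C. (x \<bullet> b) *\<^sub>R b) \<le> (\<Sum>b\<in>C. 1)"
      using that C by (intro sum_norm_le) (auto simp: thicken_def orthonormal_basis_def)
    also have "norm (orth_proj E x) \<le> R" using that R by (auto simp: thicken_def)
    finally show ?thesis by simp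
  qed
  then show ?thesis unfolding bounded_iff by blast
qed

lemma convex_thicken:
  assumes E: "subspace E" and A: "convex A"
  shows "convex (thicken E C A)"
proof (rule convexI)
  fix u v :: real and x y assume uv: "0 \<le> u" "0 \<le> v" "u + v = 1" and x: "x \<in> thicken E C A" and y: "y \<in> thicken E C A"
  have "orth_proj E (u *\<^sub>R x + v *\<^sub>R y) = u *\<^sub>R orth_proj E x + v *\<^sub>R orth_proj E y"
    using linear_orth_proj[OF E] by (simp add: linear_add linear_scale)
  moreover have "u *\<^sub>R orth_proj E x + v *\<^sub>R orth_proj E y \<in> A"
    using x y uv A by (intro convexD) (auto simp: thicken_def)
  moreover have "\<bar>(u *\<^sub>R x + v *\<^sub>R y) \<bullet> c\<bar> \<le> 1" if "c \<in> C" for c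
  proof -
    have "\<bar>(u *\<^sub>R x + v *\<^sub>R y) \<bullet> c\<bar> \<le> u * \<bar>x \<bullet> c\<bar> + v * \<bar>y \<bullet> c\<bar>"
      using abs_triangle_ineq[of "u * (x \<bullet> c)" "v * (y \<bullet> c)"] uv by (simp add: inner_add_left abs_mult)
    also have "\<dots> \<le> u * 1 + v * 1"
      using x y uv that by (intro add_mono mult_left_mono) (auto simp: thicken_def)
    finally show ?thesis using uv by simp
  qed
  ultimately show "u *\<^sub>R x + v *\<^sub>R y \<in> thicken E C A" by (simp add: thicken_def)
qed

lemma emeasure_coord_measure_bounded:
  fixes B :: "'a::euclidean_space set"
  assumes B: "orthonormal_basis B E" and A: "bounded A" "A \<in> sets borel"
  shows "emeasure (coord_measure B) A < \<infinity>"
proof -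
  have E: "subspace E" unfolding orthonormal_basisD(3)[OF B, symmetric] by (rule subspace_span)
  obtain C where C: "orthonormal_basis C (orthogonal_comp E)"
    using orthonormal_basis_exists[OF subspace_orthogonal_comp] by blast
  have "emeasure lborel (thicken E C A) < \<infinity>"
    by (intro emeasure_bounded_finite bounded_thicken E C A)
  then show ?thesis
    unfolding emeasure_thicken[OF B C A(2)] by (auto simp: ennreal_mult_less_top ennreal_mult_eq_top_iff less_top)
qed

lemma measure_lebesgue_subspace_proj:
  fixes K :: "'a::euclidean_space set"
  assumes E: "subspace E" and K: "compact K"
  obtains B where "orthonormal_basis B E"
    "ennreal (measure (lebesgue_subspace E) (orth_proj E ` K)) = emeasure (coord_measure B) (orth_proj E ` K)"
proof -
  define B where "B = (SOME B. orthonormal_basis B E)"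
  have B: "orthonormal_basis B E"
    unfolding B_def using orthonormal_basis_exists[OF E] by (rule someI_ex)
  have K': "orth_proj E ` K \<in> sets borel" "bounded (orth_proj E ` K)"
    using compact_orth_proj[OF E K] by (auto intro: borel_compact compact_imp_bounded)
  have "lebesgue_subspace E = completion (coord_measure B)"
    by (simp add: lebesgue_subspace_def B_def coord_measure_def Let_def)
  then have "measure (lebesgue_subspace E) (orth_proj E ` K) = measure (coord_measure B) (orth_proj E ` K)"
    using K' by simp
  moreover have "emeasure (coord_measure B) (orth_proj E ` K) < \<infinity>"
    using B K' by (intro emeasure_coord_measure_bounded)
  ultimately show ?thesis
    using that[OF B] by (simp add: measure_def ennreal_enn2real less_top)
qed

section \<open>The covariogram and the projection norm\<close>

definition proj_volume :: "'a::euclidean_space set \<Rightarrow> 'a \<Rightarrow> real" where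
  "proj_volume K w = measure (lebesgue_subspace (orthogonal_comp {w})) (orth_proj (orthogonal_comp {w}) ` K)"

text \<open>
  The support function of the projection body of \<^term>\<open>K\<close>.
\<close>

definition proj_norm :: "'a::euclidean_space set \<Rightarrow> 'a \<Rightarrow> real" where
  "proj_norm K x = norm x * proj_volume K x"

text \<open>
  A full-dimensional stand-in for the projection of \<^term>\<open>S\<close> along \<^term>\<open>w\<close>, so that facts about convex sets in
  the whole space, such as their null boundaries, apply to it.
\<close>

definition cylinder :: "'a::euclidean_space \<Rightarrow> 'a set \<Rightarrow> 'a set" where
  "cylinder w S = {y. \<exists>s. y + s *\<^sub>R w \<in> S}"

definition covariogram :: "'a::euclidean_space set \<Rightarrow> 'a \<Rightarrow> real" where
  "covariogram K x = measure lborel {y\<in>K. y - x \<in> K}"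

definition translation_loss :: "'a::euclidean_space set \<Rightarrow> 'a \<Rightarrow> real" where
  "translation_loss K x = measure lborel {y\<in>K. y - x \<notin> K}"

lemma orthogonal_comp_scaleR: "c \<noteq> 0 \<Longrightarrow> orthogonal_comp {c *\<^sub>R x} = orthogonal_comp {x}"
  by (auto simp: orthogonal_comp_def orthogonal_def)

lemma orthogonal_comp_comp_singleton: "orthogonal_comp (orthogonal_comp {w}) = span {w}"
  for w :: "'a::euclidean_space"
proof -
  have "orthogonal_comp {w} = orthogonal_comp (span {w})"
    by (auto simp: orthogonal_comp_def orthogonal_def span_singleton)
  then show ?thesis by (simp add: orthogonal_comp_self)
qed

lemma orthonormal_basis_singleton:
  fixes w :: "'a::euclidean_space"
  assumes "norm w = 1"
  shows "orthonormal_basis {w} (orthogonal_comp (orthogonal_comp {w}))"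
  using assms by (simp add: orthonormal_basis_def orthogonal_comp_comp_singleton pairwise_def)

lemma nn_integral_lborel_fibres:
  fixes w :: "'a::euclidean_space"
  assumes w: "norm w = 1" and B: "orthonormal_basis B (orthogonal_comp {w})"
    and [measurable]: "f \<in> borel_measurable borel"
  shows "(\<integral>\<^sup>+x. f x \<partial>lborel) = (\<integral>\<^sup>+y. (\<integral>\<^sup>+s. f (y + s *\<^sub>R w) \<partial>lborel) \<partial>coord_measure B)"
proof -
  have "(\<integral>\<^sup>+x. f x \<partial>lborel) = (\<integral>\<^sup>+y. (\<integral>\<^sup>+z. f (y + z) \<partial>coord_measure {w}) \<partial>coord_measure B)"
    by (rule nn_integral_lborel_orthonormal_split(1)[OF B orthonormal_basis_singleton[OF w]]) measurable
  also have "\<dots> = (\<integral>\<^sup>+y. (\<integral>\<^sup>+s. f (y + s *\<^sub>R w) \<partial>lborel) \<partial>coord_measure B)"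
  proof (rule nn_integral_cong)
    fix y
    show "(\<integral>\<^sup>+z. f (y + z) \<partial>coord_measure {w}) = (\<integral>\<^sup>+s. f (y + s *\<^sub>R w) \<partial>lborel)"
      by (subst nn_integral_coord_measure_insert) (simp_all add: nn_integral_coord_measure_empty)
  qed
  finally show ?thesis .
qed

lemma closed_cylinder:
  assumes "compact S"
  shows "closed (cylinder w S)"
proof -
  have "closed (\<Union>x\<in>S. \<Union>y\<in>span {w}. {x + y})"
    using assms by (intro compact_closed_sums closed_subspace) simp_all
  also have "(\<Union>x\<in>S. \<Union>y\<in>span {w}. {x + y}) = cylinder w S"
  proof (intro equalityI subsetI)
    fix z assume "z \<in> (\<Union>x\<in>S. \<Union>y\<in>span {w}. {x + y})"
    then obtain x k where "x \<in> S" "z = x + k *\<^sub>R w" by (auto simp: span_singleton)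
    then have "z + (-k) *\<^sub>R w \<in> S" by simp
    then show "z \<in> cylinder w S" unfolding cylinder_def by blast
  next
    fix z assume "z \<in> cylinder w S"
    then obtain s where s: "z + s *\<^sub>R w \<in> S" by (auto simp: cylinder_def)
    have "z = (z + s *\<^sub>R w) + (-s) *\<^sub>R w" by simp
    then show "z \<in> (\<Union>x\<in>S. \<Union>y\<in>span {w}. {x + y})"
      using s by (auto simp: span_singleton intro!: bexI[of _ "z + s *\<^sub>R w"] exI[of _ "-s"])
  qed
  finally show ?thesis .
qed

lemma convex_cylinder:
  assumes "convex S"
  shows "convex (cylinder w S)"
proof (rule convexI)
  fix x y u v :: real and a b assume uv: "0 \<le> u" "0 \<le> v" "u + v = 1" and "a \<in> cylinder w S" "b \<in> cylinder w S"
  then obtain s t where "a + s *\<^sub>R w \<in> S" "b + t *\<^sub>R w \<in> S" by (auto simp: cylinder_def)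
  then have "u *\<^sub>R (a + s *\<^sub>R w) + v *\<^sub>R (b + t *\<^sub>R w) \<in> S" using assms uv by (intro convexD)
  also have "u *\<^sub>R (a + s *\<^sub>R w) + v *\<^sub>R (b + t *\<^sub>R w) = (u *\<^sub>R a + v *\<^sub>R b) + (u * s + v * t) *\<^sub>R w"
    by (simp add: algebra_simps)
  finally show "u *\<^sub>R a + v *\<^sub>R b \<in> cylinder w S" unfolding cylinder_def by blast
qed

lemma proj_volume_cylinder:
  fixes w :: "'a::euclidean_space"
  assumes w: "norm w = 1" and K: "compact K"
  obtains B where "orthonormal_basis B (orthogonal_comp {w})"
    "ennreal (proj_volume K w) = emeasure (coord_measure B) (cylinder w K)"
proof -
  let ?E = "orthogonal_comp {w}"
  have E: "subspace ?E" by (rule subspace_orthogonal_comp)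
  obtain B where B: "orthonormal_basis B ?E"
    "ennreal (proj_volume K w) = emeasure (coord_measure B) (orth_proj ?E ` K)"
    unfolding proj_volume_def by (rule measure_lebesgue_subspace_proj[OF E K])
  note b = orthonormal_basisD[OF B(1)]
  have "emeasure (coord_measure B) (orth_proj ?E ` K) = emeasure (coord_measure B) (cylinder w K)"
  proof (rule emeasure_eq_AE)
    show "AE x in coord_measure B. (x \<in> orth_proj ?E ` K) = (x \<in> cylinder w K)"
      using AE_coord_measure_span[OF b(1)]
    proof eventually_elim
      fix x assume "x \<in> span B"
      then have x: "x \<in> ?E" by (simp add: b(3))
      show "(x \<in> orth_proj ?E ` K) = (x \<in> cylinder w K)"
      proof
        assume "x \<in> orth_proj ?E ` K"
        then obtain k where k: "k \<in> K" "x = orth_proj ?E k" by auto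
        then have "k - x \<in> span {w}" using orth_proj_in(2)[OF E, of k] by (simp add: orthogonal_comp_comp_singleton)
        then obtain s where "k - x = s *\<^sub>R w" by (auto simp: span_singleton)
        then have "x + s *\<^sub>R w = k" by (simp add: algebra_simps)
        then show "x \<in> cylinder w K" unfolding cylinder_def using k(1) by blast
      next
        assume "x \<in> cylinder w K"
        then obtain s where s: "x + s *\<^sub>R w \<in> K" by (auto simp: cylinder_def)
        have "s *\<^sub>R w \<in> orthogonal_comp ?E"
          unfolding orthogonal_comp_comp_singleton by (simp add: span_base span_scale)
        then have "orth_proj ?E (x + s *\<^sub>R w) = x" by (rule orth_proj_add[OF E x])
        then show "x \<in> orth_proj ?E ` K" using s by (metis image_eqI)
      qed
    qed
    show "orth_proj ?E ` K \<in> sets (coord_measure B)" "cylinder w K \<in> sets (coord_measure B)"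
      using compact_orth_proj[OF E K] closed_cylinder[OF K] by (auto intro: borel_compact)
  qed
  then show ?thesis using that B by simp
qed

text \<open>
  The points lost by an interval are its initial segment of length \<^term>\<open>r\<close>, or the whole interval if that is
  shorter.
\<close>

lemma emeasure_interval_loss:
  fixes S :: "real set"
  assumes S: "compact S" "convex S" and r: "0 < r"
  shows "emeasure lborel {s\<in>S. s - r \<notin> S} \<le> ennreal r * indicator {S. S \<noteq> {}} S"
    "ennreal r * indicator {S. \<exists>s. s \<in> S \<and> s + r \<in> S} S \<le> emeasure lborel {s\<in>S. s - r \<notin> S}"
proof -
  have "\<exists>a b. S = {a..b}" using S connected_compact_interval_1 convex_connected by metis
  then obtain a b where ab: "S = {a..b}" by blast
  have m: "{s\<in>S. s - r \<notin> S} \<in> sets lborel"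
  proof -
    have "{s\<in>S. s - r \<notin> S} = {a..b} - {a+r..b+r}" unfolding ab using r by auto
    then show ?thesis by simp
  qed
  show "emeasure lborel {s\<in>S. s - r \<notin> S} \<le> ennreal r * indicator {S. S \<noteq> {}} S"
  proof (cases "S = {}")
    case False
    have "{s\<in>S. s - r \<notin> S} \<subseteq> {a..a+r}" unfolding ab using r by auto
    then have "emeasure lborel {s\<in>S. s - r \<notin> S} \<le> emeasure lborel {a..a+r}" by (intro emeasure_mono) auto
    then show ?thesis using r False by simp
  qed simp
  show "ennreal r * indicator {S. \<exists>s. s \<in> S \<and> s + r \<in> S} S \<le> emeasure lborel {s\<in>S. s - r \<notin> S}"
  proof (cases "\<exists>s. s \<in> S \<and> s + r \<in> S")
    case True
    then have "{a<..<a+r} \<subseteq> {s\<in>S. s - r \<notin> S}" unfolding ab by auto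
    then have "emeasure lborel {a<..<a+r} \<le> emeasure lborel {s\<in>S. s - r \<notin> S}" using m by (intro emeasure_mono) auto
    then show ?thesis using r True by simp
  qed simp
qed

lemma compact_Int_translate:
  fixes x :: "'a::euclidean_space"
  assumes "compact K"
  shows "compact {y\<in>K. y - x \<in> K}" "compact {y\<in>K. y + x \<in> K}"
proof -
  have 1: "compact {y\<in>K. y - x \<in> K}" for x
  proof -
    have "{y\<in>K. y - x \<in> K} = K \<inter> (\<lambda>y. y + x) ` K"
    proof (intro equalityI subsetI)
      fix y assume "y \<in> {y\<in>K. y - x \<in> K}"
      then show "y \<in> K \<inter> (\<lambda>y. y + x) ` K" by (auto intro!: image_eqI[of _ _ "y - x"])
    qed auto
    then show ?thesis using assms by (auto intro!: compact_Int compact_translation_subtract simp: add.commute[of _ x] compact_translation)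
  qed
  show "compact {y\<in>K. y - x \<in> K}" by (rule 1)
  show "compact {y\<in>K. y + x \<in> K}" using 1[of "- x"] by simp
qed

lemma convex_Int_translate:
  fixes x :: "'a::euclidean_space"
  assumes "convex K"
  shows "convex {y\<in>K. y - x \<in> K}" "convex {y\<in>K. y + x \<in> K}"
proof -
  have 1: "convex {y\<in>K. y - x \<in> K}" for x
  proof (rule convexI)
    fix u v :: real and a b assume uv: "0 \<le> u" "0 \<le> v" "u + v = 1" and "a \<in> {y\<in>K. y - x \<in> K}" "b \<in> {y\<in>K. y - x \<in> K}"
    then have "u *\<^sub>R a + v *\<^sub>R b \<in> K" "u *\<^sub>R (a - x) + v *\<^sub>R (b - x) \<in> K"
      using assms by (auto intro!: convexD)
    moreover have "u *\<^sub>R (a - x) + v *\<^sub>R (b - x) = (u *\<^sub>R a + v *\<^sub>R b) - (u + v) *\<^sub>R x" by (simp add: algebra_simps)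
    ultimately show "u *\<^sub>R a + v *\<^sub>R b \<in> {y\<in>K. y - x \<in> K}" using uv by simp
  qed
  show "convex {y\<in>K. y - x \<in> K}" by (rule 1)
  show "convex {y\<in>K. y + x \<in> K}" using 1[of "- x"] by simp
qed

lemma compact_fmeasurable: "compact K \<Longrightarrow> K \<in> fmeasurable lborel" for K :: "'a::euclidean_space set"
  using emeasure_bounded_finite[OF compact_imp_bounded] by (auto intro!: fmeasurableI borel_compact)

lemma translation_loss_eq:
  fixes K :: "'a::euclidean_space set"
  assumes "compact K"
  shows "translation_loss K x = measure lborel K - covariogram K x"
    "{y\<in>K. y - x \<notin> K} \<in> fmeasurable lborel"
proof -
  have eq: "{y\<in>K. y - x \<notin> K} = K - {y\<in>K. y - x \<in> K}" by auto
  have fm: "K \<in> fmeasurable lborel" "{y\<in>K. y - x \<in> K} \<in> fmeasurable lborel"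
    using assms compact_Int_translate by (auto intro!: compact_fmeasurable)
  then show "{y\<in>K. y - x \<notin> K} \<in> fmeasurable lborel" unfolding eq by (intro fmeasurable.Diff)
  show "translation_loss K x = measure lborel K - covariogram K x"
    unfolding translation_loss_def eq covariogram_def using fm
    by (subst measurable_measure_Diff) (auto dest: fmeasurableD)
qed

lemma translation_loss_bounds:
  fixes w :: "'a::euclidean_space"
  assumes w: "norm w = 1" and B: "orthonormal_basis B (orthogonal_comp {w})"
    and K: "compact K" "convex K" and r: "0 < r"
  shows "ennreal (translation_loss K (r *\<^sub>R w)) \<le> ennreal r * emeasure (coord_measure B) (cylinder w K)"
    "ennreal r * emeasure (coord_measure B) (cylinder w {y\<in>K. y + r *\<^sub>R w \<in> K}) \<le> ennreal (translation_loss K (r *\<^sub>R w))"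
proof -
  let ?D = "{y\<in>K. y - r *\<^sub>R w \<notin> K}"
  have D: "?D \<in> fmeasurable lborel" using translation_loss_eq(2)[OF K(1)] .
  then have Dm[measurable]: "?D \<in> sets borel" by (auto dest: fmeasurableD)
  have cm: "cylinder w K \<in> sets borel" "cylinder w {y\<in>K. y + r *\<^sub>R w \<in> K} \<in> sets borel"
    using K compact_Int_translate by (auto intro!: borel_closed closed_cylinder)
  define S where "S y = {s. y + s *\<^sub>R w \<in> K}" for y
  have S: "compact (S y)" "convex (S y)" for y
  proof -
    have "S y = (\<lambda>s. y + s *\<^sub>R w) -` K" by (auto simp: S_def)
    then have "closed (S y)"
      using closed_vimage[OF compact_imp_closed[OF K(1)], of "\<lambda>s. y + s *\<^sub>R w"]
      by (simp add: continuous_intros)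
    moreover have "bounded (S y)"
    proof -
      obtain R where R: "\<And>x. x \<in> K \<Longrightarrow> norm x \<le> R" using compact_imp_bounded[OF K(1)] unfolding bounded_iff by blast
      have "norm s \<le> R + norm y" if "s \<in> S y" for s
      proof -
        have "norm (s *\<^sub>R w) \<le> norm (y + s *\<^sub>R w) + norm y" using norm_triangle_ineq4[of "y + s *\<^sub>R w" y] by simp
        then show ?thesis using R[of "y + s *\<^sub>R w"] that w by (simp add: S_def)
      qed
      then show ?thesis unfolding bounded_iff by blast
    qed
    ultimately show "compact (S y)" by (simp add: compact_eq_bounded_closed)
    show "convex (S y)"
    proof (rule convexI)
      fix u v a b :: real assume uv: "0 \<le> u" "0 \<le> v" "u + v = 1" and "a \<in> S y" "b \<in> S y"
      then have "u *\<^sub>R (y + a *\<^sub>R w) + v *\<^sub>R (y + b *\<^sub>R w) \<in> K"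
        using K(2) by (intro convexD) (auto simp: S_def)
      also have "u *\<^sub>R (y + a *\<^sub>R w) + v *\<^sub>R (y + b *\<^sub>R w) = (u + v) *\<^sub>R y + (u * a + v * b) *\<^sub>R w" by (simp add: algebra_simps)
      finally show "u *\<^sub>R a + v *\<^sub>R b \<in> S y" using uv by (simp add: S_def)
    qed
  qed
  have "ennreal (translation_loss K (r *\<^sub>R w)) = emeasure lborel ?D"
    unfolding translation_loss_def using D by (subst emeasure_eq_measure2) (auto simp: fmeasurable_def)
  also have "\<dots> = (\<integral>\<^sup>+y. indicator ?D y \<partial>lborel)" by simp
  also have "\<dots> = (\<integral>\<^sup>+y. (\<integral>\<^sup>+s. indicator ?D (y + s *\<^sub>R w) \<partial>lborel) \<partial>coord_measure B)"
    by (rule nn_integral_lborel_fibres[OF w B]) measurable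
  also have "\<dots> = (\<integral>\<^sup>+y. emeasure lborel {s \<in> S y. s - r \<notin> S y} \<partial>coord_measure B)"
  proof (rule nn_integral_cong)
    fix y
    have "(\<integral>\<^sup>+s. indicator ?D (y + s *\<^sub>R w) \<partial>lborel) = (\<integral>\<^sup>+s. indicator {s \<in> S y. s - r \<notin> S y} s \<partial>lborel)"
      by (rule nn_integral_cong) (auto simp: indicator_def S_def algebra_simps)
    also have "{s \<in> S y. s - r \<notin> S y} = (\<lambda>s. y + s *\<^sub>R w) -` ?D"
      by (auto simp: S_def algebra_simps)
    then have "(\<integral>\<^sup>+s. indicator {s \<in> S y. s - r \<notin> S y} s \<partial>lborel) = emeasure lborel {s \<in> S y. s - r \<notin> S y}"
      using measurable_sets[of "\<lambda>s. y + s *\<^sub>R w" borel borel ?D] by (subst nn_integral_indicator) auto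
    finally show "(\<integral>\<^sup>+s. indicator ?D (y + s *\<^sub>R w) \<partial>lborel) = emeasure lborel {s \<in> S y. s - r \<notin> S y}" .
  qed
  finally have eq: "ennreal (translation_loss K (r *\<^sub>R w)) = (\<integral>\<^sup>+y. emeasure lborel {s \<in> S y. s - r \<notin> S y} \<partial>coord_measure B)" .
  have "\<dots> \<le> (\<integral>\<^sup>+y. ennreal r * indicator (cylinder w K) y \<partial>coord_measure B)"
  proof (rule nn_integral_mono)
    fix y
    show "emeasure lborel {s \<in> S y. s - r \<notin> S y} \<le> ennreal r * indicator (cylinder w K) y"
      using emeasure_interval_loss(1)[OF S r, of y] by (auto simp: indicator_def cylinder_def S_def split: if_splits)
  qed
  also have "\<dots> = ennreal r * emeasure (coord_measure B) (cylinder w K)"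
    using cm by (subst nn_integral_cmult) auto
  finally show "ennreal (translation_loss K (r *\<^sub>R w)) \<le> ennreal r * emeasure (coord_measure B) (cylinder w K)"
    unfolding eq .
  have "ennreal r * emeasure (coord_measure B) (cylinder w {y\<in>K. y + r *\<^sub>R w \<in> K})
      = (\<integral>\<^sup>+y. ennreal r * indicator (cylinder w {y\<in>K. y + r *\<^sub>R w \<in> K}) y \<partial>coord_measure B)"
    using cm by (subst nn_integral_cmult) auto
  also have "\<dots> \<le> (\<integral>\<^sup>+y. emeasure lborel {s \<in> S y. s - r \<notin> S y} \<partial>coord_measure B)"
  proof (rule nn_integral_mono)
    fix y
    have "y \<in> cylinder w {y\<in>K. y + r *\<^sub>R w \<in> K} \<longleftrightarrow> (\<exists>s. s \<in> S y \<and> s + r \<in> S y)"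
      by (auto simp: cylinder_def S_def algebra_simps)
    then show "ennreal r * indicator (cylinder w {y\<in>K. y + r *\<^sub>R w \<in> K}) y \<le> emeasure lborel {s \<in> S y. s - r \<notin> S y}"
      using emeasure_interval_loss(2)[OF S r, of y] by (auto simp: indicator_def split: if_splits)
  qed
  finally show "ennreal r * emeasure (coord_measure B) (cylinder w {y\<in>K. y + r *\<^sub>R w \<in> K}) \<le> ennreal (translation_loss K (r *\<^sub>R w))"
    unfolding eq .
qed

text \<open>
  By the bounds on chords, the rescaled loss is \<^term>\<open>r\<close> times a number between the volume of the
  projection and the volume of those projected points whose chord has length at least $r/(k+1)$. As $k$ grows, the latter exhausts all
  points with a chord of positive length. The remaining points lie on the boundary of the cylinder over
  \<^term>\<open>K\<close>, which is convex and hence has a null boundary.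
\<close>

lemma translation_loss_limit_unit:
  fixes w :: "'a::euclidean_space"
  assumes w: "norm w = 1" and K: "compact K" "convex K" "interior K \<noteq> {}" and r: "0 < r"
  shows "(\<lambda>k. real (Suc k) * translation_loss K ((r / real (Suc k)) *\<^sub>R w)) \<longlonglongrightarrow> r * proj_volume K w"
    and "translation_loss K (r *\<^sub>R w) \<le> r * proj_volume K w"
proof -
  obtain B where B: "orthonormal_basis B (orthogonal_comp {w})"
    and pv: "ennreal (proj_volume K w) = emeasure (coord_measure B) (cylinder w K)"
    using proj_volume_cylinder[OF w K(1)] by metis
  have pv0: "proj_volume K w \<ge> 0" by (simp add: proj_volume_def)
  define C where "C k = cylinder w {y\<in>K. y + (r / real (Suc k)) *\<^sub>R w \<in> K}" for k
  have C[measurable]: "C k \<in> sets borel" for k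
    unfolding C_def using K compact_Int_translate by (auto intro!: borel_closed closed_cylinder)
  have cK[measurable]: "cylinder w K \<in> sets borel"
    using K by (auto intro!: borel_closed closed_cylinder)
  have CK: "C k \<subseteq> cylinder w K" for k by (auto simp: C_def cylinder_def)
  have "incseq C"
  proof (rule incseq_SucI, rule subsetI)
    fix k y assume "y \<in> C k"
    then obtain s where s: "y + s *\<^sub>R w \<in> K" "y + s *\<^sub>R w + (r / real (Suc k)) *\<^sub>R w \<in> K"
      by (auto simp: C_def cylinder_def)
    \<comment> \<open>The point of the chord at the smaller shift is a convex combination of its two known points.\<close>
    define t where "t = real (Suc k) / real (Suc (Suc k))"
    have t: "0 \<le> t" "t \<le> 1" by (auto simp: t_def)
    have "(1 - t) *\<^sub>R (y + s *\<^sub>R w) + t *\<^sub>R (y + s *\<^sub>R w + (r / real (Suc k)) *\<^sub>R w) \<in> K"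
      using K(2) s t by (intro convexD) auto
    also have "(1 - t) *\<^sub>R (y + s *\<^sub>R w) + t *\<^sub>R (y + s *\<^sub>R w + (r / real (Suc k)) *\<^sub>R w)
        = y + s *\<^sub>R w + (t * (r / real (Suc k))) *\<^sub>R w" by (simp add: algebra_simps)
    also have "t * (r / real (Suc k)) = r / real (Suc (Suc k))" by (simp add: t_def)
    finally show "y \<in> C (Suc k)" using s(1) unfolding C_def cylinder_def by blast
  qed
  define N where "N = cylinder w K - (\<Union>k. C k)"
  have N[measurable]: "N \<in> sets borel" unfolding N_def by measurable
  \<comment> \<open>Sets that are invariant along \<open>w\<close> and null in the whole space have null trace on the complement.\<close>
  have inv: "y + s *\<^sub>R w \<in> cylinder w S \<longleftrightarrow> y \<in> cylinder w S" for y s S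
  proof
    assume "y + s *\<^sub>R w \<in> cylinder w S"
    then obtain t where "y + s *\<^sub>R w + t *\<^sub>R w \<in> S" by (auto simp: cylinder_def)
    then have "y + (s + t) *\<^sub>R w \<in> S" by (simp add: algebra_simps)
    then show "y \<in> cylinder w S" unfolding cylinder_def by blast
  next
    assume "y \<in> cylinder w S"
    then obtain t where "y + t *\<^sub>R w \<in> S" by (auto simp: cylinder_def)
    then have "y + s *\<^sub>R w + (t - s) *\<^sub>R w \<in> S" by (simp add: algebra_simps)
    then show "y + s *\<^sub>R w \<in> cylinder w S" unfolding cylinder_def by blast
  qed
  have "y \<in> (\<Union>k. C k)" if y: "y \<in> interior (cylinder w K)" for y
  proof -
    obtain z where z: "z \<in> interior K" using K(3) by blast
    obtain e where e: "e > 0" "ball y e \<subseteq> cylinder w K" using y by (meson mem_interior)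
    \<comment> \<open>Push \<open>y\<close> slightly away from an interior point \<open>z\<close>, pick a point of \<open>K\<close> on the line above, and
      move back towards \<open>z\<close>: this reaches an interior point of \<open>K\<close> above \<open>y\<close>.\<close>
    define \<delta> where "\<delta> = e / (2 * (norm (y - z) + 1))"
    have \<delta>: "\<delta> > 0" using e(1) by (simp add: \<delta>_def add_nonneg_pos)
    have "norm (\<delta> *\<^sub>R (y - z)) < e"
    proof -
      have "norm (\<delta> *\<^sub>R (y - z)) = \<delta> * norm (y - z)" using \<delta> by simp
      also have "\<dots> < \<delta> * (2 * (norm (y - z) + 1))"
      proof (rule mult_strict_left_mono[OF _ \<delta>])
        have "0 < norm (y - z) + 2" by (intro add_nonneg_pos) simp_all
        then show "norm (y - z) < 2 * (norm (y - z) + 1)" by simp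
      qed
      also have "\<dots> = e"
      proof -
        have "norm (y - z) + 1 \<noteq> 0" using norm_ge_zero[of "y - z"] by linarith
        then show ?thesis by (simp add: \<delta>_def)
      qed
      finally show ?thesis .
    qed
    then have "y + \<delta> *\<^sub>R (y - z) \<in> cylinder w K" using e(2) by (auto simp: subset_eq dist_norm)
    then obtain s where s: "y + \<delta> *\<^sub>R (y - z) + s *\<^sub>R w \<in> K" by (auto simp: cylinder_def)
    define t where "t = \<delta> / (1 + \<delta>)"
    have t: "0 < t" "t \<le> 1" "(1 - t) * (1 + \<delta>) = 1" "(1 - t) * \<delta> = t" using \<delta> by (auto simp: t_def field_simps)
    define q where "q = y + \<delta> *\<^sub>R (y - z) + s *\<^sub>R w"
    have "q - t *\<^sub>R (q - z) \<in> interior K"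
      using mem_interior_convex_shrink[OF K(2) z _ t(1,2), of q] s by (simp add: q_def)
    also have "q - t *\<^sub>R (q - z) = ((1 - t) * (1 + \<delta>)) *\<^sub>R y + (t - (1 - t) * \<delta>) *\<^sub>R z + ((1 - t) * s) *\<^sub>R w"
      by (simp add: q_def algebra_simps)
    also have "\<dots> = y + ((1 - t) * s) *\<^sub>R w" using t by simp
    finally have int: "y + ((1 - t) * s) *\<^sub>R w \<in> interior K" .
    then obtain e' where e': "e' > 0" "ball (y + ((1 - t) * s) *\<^sub>R w) e' \<subseteq> K" by (meson mem_interior)
    obtain k where k: "r / real (Suc k) < e'"
    proof -
      obtain n where "inverse (real (Suc n)) < e' / r" using reals_Archimedean[of "e' / r"] e' r by auto
      then show ?thesis using r that[of n] by (simp add: field_simps)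
    qed
    have "y + ((1 - t) * s) *\<^sub>R w + (r / real (Suc k)) *\<^sub>R w \<in> ball (y + ((1 - t) * s) *\<^sub>R w) e'"
      using k r w by (simp add: dist_norm)
    then have "y + ((1 - t) * s) *\<^sub>R w + (r / real (Suc k)) *\<^sub>R w \<in> K" using e' by blast
    moreover have "y + ((1 - t) * s) *\<^sub>R w \<in> K" using int interior_subset by blast
    ultimately have "y \<in> C k" unfolding C_def cylinder_def by blast
    then show ?thesis by blast
  qed
  then have "N \<subseteq> frontier (cylinder w K)"
    using closure_subset[of "cylinder w K"] by (auto simp: N_def frontier_def)
  moreover have "negligible (frontier (cylinder w K))"
    by (intro negligible_convex_frontier convex_cylinder K)
  ultimately have "negligible N" using negligible_subset by blast
  then have "emeasure lborel N = 0" using N by (simp add: negligible_iff_null_sets null_sets_def)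
  then have "(\<integral>\<^sup>+x. indicator N x \<partial>lborel) = 0" by simp
  then have "(\<integral>\<^sup>+y. (\<integral>\<^sup>+s. indicator N (y + s *\<^sub>R w) \<partial>lborel) \<partial>coord_measure B) = 0"
    by (subst (asm) nn_integral_lborel_fibres[OF w B]) auto
  also have "(\<integral>\<^sup>+y. (\<integral>\<^sup>+s. indicator N (y + s *\<^sub>R w) \<partial>lborel) \<partial>coord_measure B)
      = (\<integral>\<^sup>+y. \<infinity> * indicator N y \<partial>coord_measure B)"
  proof (rule nn_integral_cong)
    fix y
    have "indicator N (y + s *\<^sub>R w) = (indicator N y :: ennreal)" for s
      by (auto simp: N_def C_def inv indicator_def)
    then show "(\<integral>\<^sup>+s. indicator N (y + s *\<^sub>R w) \<partial>lborel) = \<infinity> * indicator N y"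
      by (simp add: mult.commute)
  qed
  also have "\<dots> = \<infinity> * emeasure (coord_measure B) N"
    by (subst nn_integral_cmult) auto
  finally have N0: "emeasure (coord_measure B) N = 0" by simp
  have "emeasure (coord_measure B) (\<Union>k. C k) = emeasure (coord_measure B) (cylinder w K)"
  proof -
    have "cylinder w K = (\<Union>k. C k) \<union> N" using CK by (auto simp: N_def)
    then show ?thesis using N0 by (simp add: emeasure_Un_null_set null_sets_def)
  qed
  moreover have "(\<lambda>k. emeasure (coord_measure B) (C k)) \<longlonglongrightarrow> emeasure (coord_measure B) (\<Union>k. C k)"
    using \<open>incseq C\<close> by (intro Lim_emeasure_incseq) auto
  ultimately have lim: "(\<lambda>k. emeasure (coord_measure B) (C k)) \<longlonglongrightarrow> ennreal (proj_volume K w)"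
    using pv by simp
  have eC: "emeasure (coord_measure B) (C k) = ennreal (measure (coord_measure B) (C k))" for k
  proof -
    have "emeasure (coord_measure B) (C k) \<le> ennreal (proj_volume K w)"
      unfolding pv using CK by (intro emeasure_mono) auto
    then show ?thesis by (intro emeasure_eq_ennreal_measure) (auto simp: top_unique)
  qed
  have lim': "(\<lambda>k. measure (coord_measure B) (C k)) \<longlonglongrightarrow> proj_volume K w"
    using lim pv0 unfolding eC by simp
  have bounds: "real (Suc k) * translation_loss K ((r / real (Suc k)) *\<^sub>R w) \<le> r * proj_volume K w"
     "r * measure (coord_measure B) (C k) \<le> real (Suc k) * translation_loss K ((r / real (Suc k)) *\<^sub>R w)" for k
  proof -
    have rk: "r / real (Suc k) > 0" using r by simp
    note tb = translation_loss_bounds[OF w B K(1,2) rk]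
    have "translation_loss K ((r / real (Suc k)) *\<^sub>R w) \<le> r / real (Suc k) * proj_volume K w"
      using tb(1) pv0 rk unfolding pv[symmetric] ennreal_mult'[OF less_imp_le[OF rk], symmetric]
      by (subst (asm) ennreal_le_iff) (simp_all only: mult_nonneg_nonneg less_imp_le)
    then show "real (Suc k) * translation_loss K ((r / real (Suc k)) *\<^sub>R w) \<le> r * proj_volume K w"
      by (simp add: field_simps)
    have "r / real (Suc k) * measure (coord_measure B) (C k) \<le> translation_loss K ((r / real (Suc k)) *\<^sub>R w)"
      using tb(2) rk unfolding C_def[symmetric] eC by (simp add: ennreal_mult[symmetric] translation_loss_def)
    then show "r * measure (coord_measure B) (C k) \<le> real (Suc k) * translation_loss K ((r / real (Suc k)) *\<^sub>R w)"
      by (simp add: field_simps)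
  qed
  show "(\<lambda>k. real (Suc k) * translation_loss K ((r / real (Suc k)) *\<^sub>R w)) \<longlonglongrightarrow> r * proj_volume K w"
  proof (rule tendsto_sandwich)
    show "(\<lambda>k. r * measure (coord_measure B) (C k)) \<longlonglongrightarrow> r * proj_volume K w"
      by (intro tendsto_intros lim')
    show "(\<lambda>k. r * proj_volume K w) \<longlonglongrightarrow> r * proj_volume K w" by simp
  qed (use bounds in auto)
  show "translation_loss K (r *\<^sub>R w) \<le> r * proj_volume K w" using bounds(1)[of 0] by simp
qed

lemma proj_volume_scaleR: "c \<noteq> 0 \<Longrightarrow> proj_volume K (c *\<^sub>R w) = proj_volume K w"
  by (simp add: proj_volume_def orthogonal_comp_scaleR)

lemma proj_norm_scaleR: "proj_norm K (c *\<^sub>R x) = \<bar>c\<bar> * proj_norm K x"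
  by (cases "c = 0") (simp_all add: proj_norm_def proj_volume_scaleR)

lemma translation_loss_limit:
  fixes x :: "'a::euclidean_space"
  assumes K: "compact K" "convex K" "interior K \<noteq> {}"
  shows "(\<lambda>k. real (Suc k) * translation_loss K (x /\<^sub>R real (Suc k))) \<longlonglongrightarrow> proj_norm K x"
    and "translation_loss K x \<le> proj_norm K x"
proof -
  show "(\<lambda>k. real (Suc k) * translation_loss K (x /\<^sub>R real (Suc k))) \<longlonglongrightarrow> proj_norm K x"
  proof (cases "x = 0")
    case True
    then show ?thesis by (simp add: proj_norm_def translation_loss_def)
  next
    case False
    define w where "w = x /\<^sub>R norm x"
    have w: "norm w = 1" "x = norm x *\<^sub>R w" using False by (auto simp: w_def)
    have "(\<lambda>k. real (Suc k) * translation_loss K ((norm x / real (Suc k)) *\<^sub>R w)) \<longlonglongrightarrow> norm x * proj_volume K w"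
      using False by (intro translation_loss_limit_unit w K) auto
    moreover have "(norm x / real (Suc k)) *\<^sub>R w = x /\<^sub>R real (Suc k)" for k
      using w(2) by (metis divide_inverse mult.commute scaleR_scaleR)
    moreover have "proj_volume K w = proj_volume K x"
      unfolding w_def using False by (intro proj_volume_scaleR) auto
    ultimately show ?thesis by (simp add: proj_norm_def)
  qed
  show "translation_loss K x \<le> proj_norm K x"
  proof (cases "x = 0")
    case True
    then show ?thesis by (simp add: proj_norm_def translation_loss_def)
  next
    case False
    define w where "w = x /\<^sub>R norm x"
    have w: "norm w = 1" "norm x *\<^sub>R w = x" using False by (auto simp: w_def)
    have "translation_loss K (norm x *\<^sub>R w) \<le> norm x * proj_volume K w"
      using False by (intro translation_loss_limit_unit w K) auto
    moreover have "proj_volume K w = proj_volume K x"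
      unfolding w_def using False by (intro proj_volume_scaleR) auto
    ultimately show ?thesis unfolding w(2) by (simp add: proj_norm_def)
  qed
qed

lemma measure_lborel_translate_vimage:
  fixes S :: "'a::euclidean_space set"
  assumes [measurable]: "S \<in> sets borel"
  shows "{z. z - x \<in> S} \<in> sets borel" "emeasure lborel {z. z - x \<in> S} = emeasure lborel S"
proof -
  show m[measurable]: "{z. z - x \<in> S} \<in> sets borel" by measurable
  have "emeasure lborel {z. z - x \<in> S} = (\<integral>\<^sup>+z. indicator S (z + (- x)) \<partial>lborel)"
  proof -
    have "indicator S (z + (- x)) = (indicator {z. z - x \<in> S} z :: ennreal)" for z
      by (simp add: indicator_def)
    then show ?thesis by simp
  qed
  also have "\<dots> = (\<integral>\<^sup>+z. indicator S z \<partial>lborel)" by (rule nn_integral_lborel_translate) measurable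
  finally show "emeasure lborel {z. z - x \<in> S} = emeasure lborel S" by simp
qed

text \<open>
  Subtract \<^term>\<open>x\<close> first and then \<^term>\<open>y\<close>: a point of \<^term>\<open>K\<close> that ends outside \<^term>\<open>K\<close> leaves it in the first step,
  or it is still in \<^term>\<open>K\<close> after the first step and leaves in the second.
\<close>

lemma translation_loss_subadditive:
  fixes K :: "'a::euclidean_space set"
  assumes K: "compact K"
  shows "translation_loss K (x + y) \<le> translation_loss K x + translation_loss K y"
proof -
  let ?D = "\<lambda>x. {z\<in>K. z - x \<notin> K}"
  have D: "?D x \<in> fmeasurable lborel" for x by (rule translation_loss_eq(2)[OF K])
  note D' = fmeasurableD[OF D]
  let ?Y = "{z. z - x \<in> ?D y}"
  have m: "?Y \<in> sets lborel" "emeasure lborel ?Y = emeasure lborel (?D y)"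
    using measure_lborel_translate_vimage[of "?D y" x] D[of y] by (auto dest: fmeasurableD)
  then have Y: "?Y \<in> fmeasurable lborel" using D[of y] by (auto simp: fmeasurable_def)
  have "?D (x + y) \<subseteq> ?D x \<union> ?Y" by (auto simp: algebra_simps)
  then have "measure lborel (?D (x + y)) \<le> measure lborel (?D x \<union> ?Y)"
    using D' D Y by (intro measure_mono_fmeasurable fmeasurable.Un) auto
  also have "\<dots> \<le> measure lborel (?D x) + measure lborel ?Y"
    using D' fmeasurableD[OF Y] by (intro measure_Un_le)
  also have "measure lborel ?Y = measure lborel (?D y)" using m(2) by (simp add: measure_def)
  finally show ?thesis by (simp add: translation_loss_def)
qed

lemma proj_norm_triangle:
  fixes K :: "'a::euclidean_space set"
  assumes K: "compact K" "convex K" "interior K \<noteq> {}"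
  shows "proj_norm K (x + y) \<le> proj_norm K x + proj_norm K y"
proof (rule LIMSEQ_le)
  show "(\<lambda>k. real (Suc k) * translation_loss K ((x + y) /\<^sub>R real (Suc k))) \<longlonglongrightarrow> proj_norm K (x + y)"
    by (rule translation_loss_limit(1)[OF K])
  show "(\<lambda>k. real (Suc k) * translation_loss K (x /\<^sub>R real (Suc k)) + real (Suc k) * translation_loss K (y /\<^sub>R real (Suc k)))
      \<longlonglongrightarrow> proj_norm K x + proj_norm K y"
    by (intro tendsto_add translation_loss_limit(1)[OF K])
  have "real (Suc k) * translation_loss K ((x + y) /\<^sub>R real (Suc k))
      \<le> real (Suc k) * translation_loss K (x /\<^sub>R real (Suc k)) + real (Suc k) * translation_loss K (y /\<^sub>R real (Suc k))" for k
    unfolding distrib_left[symmetric] scaleR_add_right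
    by (intro mult_left_mono translation_loss_subadditive K(1)) simp
  then show "\<exists>N. \<forall>k\<ge>N. real (Suc k) * translation_loss K ((x + y) /\<^sub>R real (Suc k))
      \<le> real (Suc k) * translation_loss K (x /\<^sub>R real (Suc k)) + real (Suc k) * translation_loss K (y /\<^sub>R real (Suc k))"
    by blast
qed

lemma convex_body_measure_pos:
  fixes K :: "'a::euclidean_space set"
  assumes K: "compact K" "interior K \<noteq> {}"
  shows "measure lborel K > 0"
proof -
  have "0 < measure lborel (interior K)"
    using K bounded_subset[OF compact_imp_bounded[OF K(1)] interior_subset] by (intro measure_open_pos) auto
  also have "\<dots> \<le> measure lborel K"
    using K interior_subset by (intro measure_mono_fmeasurable compact_fmeasurable) auto
  finally show ?thesis .
qed

text \<open>
  A translation by a large multiple of \<^term>\<open>x\<close> moves \<^term>\<open>K\<close> off itself, so the whole volume is lost.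
\<close>

lemma proj_norm_pos:
  fixes K :: "'a::euclidean_space set"
  assumes K: "compact K" "convex K" "interior K \<noteq> {}" and x: "x \<noteq> 0"
  shows "proj_norm K x > 0"
proof -
  obtain R where R: "\<And>y. y \<in> K \<Longrightarrow> norm y \<le> R" "R > 0"
    using compact_imp_bounded[OF K(1)] unfolding bounded_pos by blast
  \<comment> \<open>The translation is then longer than the diameter of \<open>K\<close>.\<close>
  define c where "c = (2 * R + 1) / norm x"
  have c: "c > 0" using R x by (simp add: c_def)
  have "norm (c *\<^sub>R x) = 2 * R + 1" using c x R(2) by (simp add: c_def)
  have "y - c *\<^sub>R x \<notin> K" if "y \<in> K" for y
  proof
    assume "y - c *\<^sub>R x \<in> K"
    then have "norm (y - (y - c *\<^sub>R x)) \<le> R + R"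
      using norm_triangle_ineq4[of y "y - c *\<^sub>R x"] R(1)[of y] R(1)[of "y - c *\<^sub>R x"] that by linarith
    then show False using \<open>norm (c *\<^sub>R x) = 2 * R + 1\<close> by simp
  qed
  then have "{y\<in>K. y - c *\<^sub>R x \<notin> K} = K" by auto
  then have "measure lborel K \<le> proj_norm K (c *\<^sub>R x)"
    using translation_loss_limit(2)[OF K, of "c *\<^sub>R x"] by (simp add: translation_loss_def)
  also have "\<dots> = c * proj_norm K x" using c by (simp add: proj_norm_scaleR)
  finally have "0 < c * proj_norm K x" using convex_body_measure_pos[OF K(1,3)] by linarith
  then show ?thesis using c by (simp add: zero_less_mult_iff)
qed

text \<open>
  Where it is positive, the $n$-th root of the covariogram lies above its chord from the origin to \<^term>\<open>x\<close>. By
  Bernoulli's inequality the loss under $l\,x$, for $0 < l < 1$, is then at most $l$ times a constant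
  determined by the value at \<^term>\<open>x\<close>. Dividing by $l$ and letting $l$ tend to zero turns the left
  side into the projection norm.
\<close>

lemma covariogram_le:
  fixes K :: "'a::euclidean_space set"
  assumes K: "compact K" "convex K" "interior K \<noteq> {}"
  shows "covariogram K x
     \<le> measure lborel K * max 0 (1 - proj_norm K x / (real DIM('a) * measure lborel K)) ^ DIM('a)"
proof (cases "covariogram K x = 0")
  case True
  then show ?thesis by simp
next
  case False
  let ?n = "DIM('a)"
  define V where "V = measure lborel K"
  have V: "V > 0" unfolding V_def by (rule convex_body_measure_pos[OF K(1,3)])
  have g: "covariogram K x > 0" using False by (simp add: covariogram_def zero_less_measure_iff)
  have gV: "covariogram K x \<le> V"
    using translation_loss_eq(1)[OF K(1), of x] by (simp add: V_def translation_loss_def) (smt (verit) measure_nonneg)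
  define G where "G = root ?n (covariogram K x) / root ?n V"
  have G: "0 \<le> G" "G \<le> 1" using gV g V by (auto simp: G_def)
  have Gn: "V * G ^ ?n = covariogram K x" using g V by (simp add: G_def power_divide)
  have ineq: "real (Suc k) * translation_loss K (x /\<^sub>R real (Suc k)) \<le> ?n * V * (1 - G)" if k: "k > 0" for k
  proof -
    define l where "l = inverse (real (Suc k))"
    have l: "0 < l" "l < 1" using k by (auto simp: l_def field_simps)
    have T: "compact {y\<in>K. y - l *\<^sub>R x \<in> K}" by (intro compact_Int_translate K)
    have *: "(1 - l) * root ?n (measure lborel K) + l * root ?n (measure lborel {y\<in>K. y - x \<in> K})
       \<le> root ?n (measure lborel {y\<in>K. y - l *\<^sub>R x \<in> K})"
    proof (rule brunn_minkowski_convex)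
      show "convex K" "bounded K" "K \<in> sets borel" "0 < measure lborel K"
        using K V by (auto simp: V_def compact_imp_bounded borel_compact)
      show "convex {y\<in>K. y - x \<in> K}" by (intro convex_Int_translate K)
      have c: "compact {y\<in>K. y - x \<in> K}" by (intro compact_Int_translate K)
      then show "bounded {y\<in>K. y - x \<in> K}" "{y\<in>K. y - x \<in> K} \<in> sets borel"
        by (auto simp: compact_imp_bounded borel_compact)
      show "0 < measure lborel {y\<in>K. y - x \<in> K}" using g by (simp add: covariogram_def)
      show "{y\<in>K. y - l *\<^sub>R x \<in> K} \<in> fmeasurable lborel" by (rule compact_fmeasurable[OF T])
      show "0 < 1 - l" "0 < l" using l by auto
      fix u v assume u: "u \<in> K" and v: "v \<in> {y\<in>K. y - x \<in> K}"
      have "(1 - l) *\<^sub>R u + l *\<^sub>R v \<in> K" "(1 - l) *\<^sub>R u + l *\<^sub>R (v - x) \<in> K"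
        using u v K(2) l by (auto intro!: convexD)
      moreover have "(1 - l) *\<^sub>R u + l *\<^sub>R v - l *\<^sub>R x = (1 - l) *\<^sub>R u + l *\<^sub>R (v - x)" by (simp add: algebra_simps)
      ultimately show "(1 - l) *\<^sub>R u + l *\<^sub>R v \<in> {y\<in>K. y - l *\<^sub>R x \<in> K}"
        by (metis (no_types, lifting) mem_Collect_eq)
    qed
    have "root ?n V * (1 - l * (1 - G)) \<le> root ?n (covariogram K (l *\<^sub>R x))"
    proof -
      have "root ?n V * (1 - l * (1 - G)) = (1 - l) * root ?n V + l * root ?n (covariogram K x)"
        using V by (simp add: G_def algebra_simps)
      also have "\<dots> \<le> root ?n (covariogram K (l *\<^sub>R x))"
        using * by (simp only: V_def covariogram_def)
      finally show ?thesis .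
    qed
    moreover have "0 \<le> 1 - l * (1 - G)" using l G by (simp add: mult_le_one)
    ultimately have "(root ?n V * (1 - l * (1 - G))) ^ ?n \<le> root ?n (covariogram K (l *\<^sub>R x)) ^ ?n"
      using V by (intro power_mono) auto
    then have 1: "V * (1 - l * (1 - G)) ^ ?n \<le> covariogram K (l *\<^sub>R x)"
      using V by (simp add: power_mult_distrib covariogram_def)
    \<comment> \<open>Replaces the derivative of the power at \<open>l = 0\<close>, so that no limit of difference quotients is needed.\<close>
    have "1 + real ?n * (- (l * (1 - G))) \<le> (1 + (- (l * (1 - G)))) ^ ?n"
      using l G by (intro Bernoulli_inequality) (simp add: mult_le_one)
    then have "V * (1 - ?n * (l * (1 - G))) \<le> V * (1 - l * (1 - G)) ^ ?n"
      using V by (intro mult_left_mono) auto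
    with 1 have "translation_loss K (l *\<^sub>R x) \<le> V * (?n * (l * (1 - G)))"
      unfolding translation_loss_eq(1)[OF K(1)] by (simp add: V_def[symmetric] algebra_simps)
    then have "real (Suc k) * translation_loss K (l *\<^sub>R x) \<le> real (Suc k) * (V * (?n * (l * (1 - G))))"
      by (intro mult_left_mono) auto
    also have "\<dots> = (real (Suc k) * l) * (?n * V * (1 - G))" by (simp only: mult_ac)
    also have "real (Suc k) * l = 1" by (simp add: l_def)
    finally show ?thesis by (simp add: l_def)
  qed
  have "proj_norm K x \<le> ?n * V * (1 - G)"
    using translation_loss_limit(1)[OF K, of x]
    by (rule LIMSEQ_le_const2) (use ineq in \<open>auto intro!: exI[of _ 1]\<close>)
  then have "G \<le> 1 - proj_norm K x / (?n * V)" using V by (simp add: field_simps)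
  then have "G \<le> max 0 (1 - proj_norm K x / (?n * V))" by simp
  then have "V * G ^ ?n \<le> V * max 0 (1 - proj_norm K x / (?n * V)) ^ ?n"
    using V G by (intro mult_left_mono power_mono) auto
  then show ?thesis unfolding Gn unfolding V_def .
qed

section \<open>Balls of a norm are dominated by a box\<close>

locale norm_function =
  fixes h :: "'a::euclidean_space \<Rightarrow> real"
  assumes triangle: "h (x + y) \<le> h x + h y"
    and scaleR: "h (c *\<^sub>R x) = \<bar>c\<bar> * h x"
    and pos: "x \<noteq> 0 \<Longrightarrow> 0 < h x"
begin

lemma zero: "h 0 = 0" using scaleR[of 0 0] by simp

lemma minus: "h (- x) = h x" using scaleR[of "-1" x] by simp

lemma convex_on: "convex_on UNIV h"
proof (rule convex_onI)
  fix t x y assume "0 < (t::real)" "t < 1"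
  then show "h ((1 - t) *\<^sub>R x + t *\<^sub>R y) \<le> (1 - t) * h x + t * h y"
    using triangle[of "(1 - t) *\<^sub>R x" "t *\<^sub>R y"] by (simp add: scaleR)
qed simp

lemma continuous_on: "continuous_on S h"
  using convex_on_continuous[OF open_UNIV convex_on] by (rule continuous_on_subset) simp

lemma measurable [measurable]: "h \<in> borel_measurable borel"
  by (intro borel_measurable_continuous_onI continuous_on)

lemma attains_min_on_sphere:
  assumes H: "subspace H" "H \<noteq> {0}"
  obtains w where "w \<in> H" "norm w = 1" "\<And>x. x \<in> H \<Longrightarrow> norm x * h w \<le> h x"
proof -
  let ?S = "H \<inter> sphere 0 1"
  have "compact ?S" using H by (intro closed_Int_compact closed_subspace) auto
  moreover have "?S \<noteq> {}"
  proof -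
    obtain x where x: "x \<in> H" "x \<noteq> 0" using H subspace_0[OF H(1)] by blast
    then have "x /\<^sub>R norm x \<in> ?S" using H by (simp add: subspace_scale)
    then show ?thesis by blast
  qed
  ultimately obtain w where w: "w \<in> ?S" "\<And>y. y \<in> ?S \<Longrightarrow> h w \<le> h y"
    using continuous_attains_inf[OF _ _ continuous_on] by metis
  have "norm x * h w \<le> h x" if x: "x \<in> H" for x
  proof (cases "x = 0")
    case True
    then show ?thesis by (simp add: zero)
  next
    case False
    have "x /\<^sub>R norm x \<in> ?S" using H x False by (simp add: subspace_scale)
    then have "h w \<le> h (x /\<^sub>R norm x)" by (rule w)
    then show ?thesis using False by (simp add: scaleR field_simps)
  qed
  then show ?thesis using w that by auto
qed

lemma bounded_sublevel: "bounded {y. h (y + v) \<le> r}"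
proof (cases "(UNIV :: 'a set) = {0}")
  case True
  then show ?thesis by (metis bounded_insert bounded_empty bounded_subset subset_UNIV)
next
  case False
  obtain w where "w \<in> UNIV" and w: "norm w = 1" "\<And>x. x \<in> UNIV \<Longrightarrow> norm x * h w \<le> h x"
    by (rule attains_min_on_sphere[OF subspace_UNIV False]) (rule that)
  have hw: "h w > 0" using w by (intro pos) auto
  have "norm y \<le> r / h w + norm v" if "h (y + v) \<le> r" for y
  proof -
    have "norm (y + v) * h w \<le> r" using w(2)[of "y + v"] that by simp
    then have "norm (y + v) \<le> r / h w" using hw by (simp add: field_simps)
    moreover have "norm y \<le> norm (y + v) + norm v" using norm_triangle_ineq4[of "y + v" v] by simp
    ultimately show ?thesis by linarith
  qed
  then show ?thesis unfolding bounded_iff by blast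
qed

lemma sublevel_measurable [measurable]: "{y. h (y + v) \<le> r} \<in> sets borel"
  by measurable

text \<open>
  If \<^term>\<open>D\<close> is the shifted ball, then half the difference of two points of \<^term>\<open>D\<close> lies in the centred ball, and
  by Brunn-Minkowski $(D - D)/2$ is at least as large as \<^term>\<open>D\<close>.
\<close>

lemma central_section_maximal:
  fixes B :: "'a set"
  assumes B: "orthonormal_basis B E"
  shows "emeasure (coord_measure B) {y. h (y + v) \<le> r} \<le> emeasure (coord_measure B) {y. h y \<le> r}"
proof -
  have E: "subspace E" unfolding orthonormal_basisD(3)[OF B, symmetric] by (rule subspace_span)
  obtain C where C: "orthonormal_basis C (orthogonal_comp E)"
    using orthonormal_basis_exists[OF subspace_orthogonal_comp] by blast
  define D where "D = thicken E C {y. h (y + v) \<le> r}"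
  define T where "T = thicken E C {y. h y \<le> r}"
  have T: "bounded T" "T \<in> sets borel"
    using bounded_sublevel[of 0 r] sublevel_measurable[of 0 r] unfolding T_def
    by (auto intro!: bounded_thicken[OF E C] thicken_measurable[OF E C])
  have D: "bounded D" "D \<in> sets borel" "convex D"
  proof -
    show "bounded D" "D \<in> sets borel"
      unfolding D_def by (intro bounded_thicken[OF E C] thicken_measurable[OF E C] bounded_sublevel sublevel_measurable)+
    have "convex {y. h (y + v) \<le> r}"
    proof (rule convexI)
      fix a b :: real and x y assume ab: "0 \<le> a" "0 \<le> b" "a + b = 1" and x: "x \<in> {y. h (y + v) \<le> r}" and y: "y \<in> {y. h (y + v) \<le> r}"
      have "a *\<^sub>R x + b *\<^sub>R y + v = a *\<^sub>R (x + v) + b *\<^sub>R (y + v)"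
      proof -
        have "a *\<^sub>R (x + v) + b *\<^sub>R (y + v) = a *\<^sub>R x + b *\<^sub>R y + (a + b) *\<^sub>R v" by (simp add: algebra_simps)
        then show ?thesis using ab(3) by simp
      qed
      then have "h (a *\<^sub>R x + b *\<^sub>R y + v) \<le> a * h (x + v) + b * h (y + v)"
        using triangle[of "a *\<^sub>R (x + v)" "b *\<^sub>R (y + v)"] ab by (simp add: scaleR)
      also have "\<dots> \<le> a * r + b * r" using ab x y by (intro add_mono mult_left_mono) auto
      also have "\<dots> = r" using ab(3) by (simp add: distrib_right[symmetric])
      finally show "a *\<^sub>R x + b *\<^sub>R y \<in> {y. h (y + v) \<le> r}" by simp
    qed
    then show "convex D" unfolding D_def by (rule convex_thicken[OF E])
  qed
  have finD: "emeasure lborel D \<noteq> \<infinity>" "emeasure lborel T \<noteq> \<infinity>"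
    using emeasure_bounded_finite[OF D(1)] emeasure_bounded_finite[OF T(1)] by auto
  have "measure lborel D \<le> measure lborel T"
  proof (cases "measure lborel D > 0")
    case True
    define D' where "D' = (*\<^sub>R) (-1) ` D"
    have "D' = (\<lambda>x. - x) -` D" unfolding D'_def by (force intro!: image_eqI[where x="- _"])
    then have D'm: "D' \<in> sets borel"
      using measurable_sets[of "\<lambda>x. - x" borel borel D] D(2) by auto
    have D': "convex D'" "bounded D'" "measure lborel D' = measure lborel D"
    proof -
      show "convex D'" "bounded D'" unfolding D'_def by (intro convex_scaling bounded_scaling D)+
      show "measure lborel D' = measure lborel D"
        using measure_lborel_scaleR[of D "-1"] D(2) D'm unfolding D'_def by (simp only: abs_neg_one) simp
    qed
    have "1/2 * root DIM('a) (measure lborel D) + 1/2 * root DIM('a) (measure lborel D') \<le> root DIM('a) (measure lborel T)"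
    proof (rule brunn_minkowski_convex)
      show "0 < measure lborel D'" using D' True by simp
      show "T \<in> fmeasurable lborel" using T finD by (auto simp: fmeasurable_def less_top)
      fix x y assume x: "x \<in> D" and "y \<in> D'"
      then have y: "- y \<in> D" by (auto simp: D'_def)
      have "orth_proj E ((1/2) *\<^sub>R x + (1/2) *\<^sub>R y) = (1/2) *\<^sub>R (orth_proj E x + v) + (1/2) *\<^sub>R (- (orth_proj E (- y) + v))"
        using linear_orth_proj[OF E] by (simp add: linear_add linear_scale linear_neg algebra_simps)
      then have "h (orth_proj E ((1/2) *\<^sub>R x + (1/2) *\<^sub>R y)) \<le> 1/2 * h (orth_proj E x + v) + 1/2 * h (orth_proj E (- y) + v)"
        using triangle[of "(1/2) *\<^sub>R (orth_proj E x + v)" "(1/2) *\<^sub>R (- (orth_proj E (- y) + v))"]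
        by (simp only: scaleR minus)
      also have "\<dots> \<le> r" using x y by (simp add: D_def thicken_def)
      finally have 1: "h (orth_proj E ((1/2) *\<^sub>R x + (1/2) *\<^sub>R y)) \<le> r" .
      have "\<bar>((1/2) *\<^sub>R x + (1/2) *\<^sub>R y) \<bullet> c\<bar> \<le> 1" if "c \<in> C" for c
      proof -
        have "\<bar>x \<bullet> c\<bar> \<le> 1" "\<bar>y \<bullet> c\<bar> \<le> 1" using x y that by (auto simp: D_def thicken_def)
        moreover have "((1/2) *\<^sub>R x + (1/2) *\<^sub>R y) \<bullet> c = (x \<bullet> c + y \<bullet> c) / 2" by (simp add: inner_add_left add_divide_distrib)
        ultimately show ?thesis by (simp add: abs_le_iff)
      qed
      with 1 show "(1/2) *\<^sub>R x + (1/2) *\<^sub>R y \<in> T" by (simp add: T_def thicken_def)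
    qed (use D D' D'm True in auto)
    then show ?thesis using D' by simp
  qed (simp add: not_less order_trans[OF _ measure_nonneg])
  then have "emeasure lborel D \<le> emeasure lborel T"
    using finD by (simp add: emeasure_eq_ennreal_measure)
  moreover have "emeasure lborel D = emeasure (coord_measure B) {y. h (y + v) \<le> r} * 2 ^ card C"
    unfolding D_def by (rule emeasure_thicken[OF B C]) measurable
  moreover have "emeasure lborel T = emeasure (coord_measure B) {y. h y \<le> r} * 2 ^ card C"
    unfolding T_def by (rule emeasure_thicken[OF B C]) measurable
  moreover have "a \<le> b" if "a * 2 ^ n \<le> b * 2 ^ n" for a b :: ennreal and n :: nat
  proof -
    have "a * 2 ^ n / 2 ^ n \<le> b * 2 ^ n / 2 ^ n" using that by (rule divide_right_mono_ennreal)
    moreover have "(2::ennreal) ^ n \<noteq> 0" "(2::ennreal) ^ n \<noteq> \<infinity>" by (auto simp: power_eq_top_ennreal)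
    ultimately show ?thesis by (simp add: ennreal_mult_divide_eq)
  qed
  ultimately show ?thesis by metis
qed

text \<open>
  The basis is chosen greedily: a minimiser $w$ of \<^term>\<open>h\<close> on the unit sphere of \<^term>\<open>H\<close>, then recursively in
  its complement. Minimality gives $|s| \le \|x\| \le h(x)/h(w)$ for the coordinate $s$ of $x$ along $w$,
  which confines the ball to a slab.
  The bound is needed for all radii at once, with a basis that does not depend on the radius.
\<close>

theorem exists_basis_sublevel_le_box:
  assumes "subspace H"
  shows "\<exists>W. orthonormal_basis W H \<and>
    (\<forall>r\<ge>0. emeasure (coord_measure W) {x. h x \<le> r} \<le> ennreal (\<Prod>w\<in>W. 2 * r / h w))"
  using assms
proof (induction "dim H" arbitrary: H rule: less_induct)
  case less
  show ?case
  proof (cases "H = {0}")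
    case True
    have "emeasure (coord_measure {}) {x. h x \<le> r} \<le> 1" for r
    proof -
      have "emeasure (coord_measure {}) {x. h x \<le> r} = (\<integral>\<^sup>+x. indicator {x. h x \<le> r} x \<partial>coord_measure {})"
        by (subst nn_integral_indicator) auto
      also have "\<dots> = indicator {x. h x \<le> r} 0"
        by (rule nn_integral_coord_measure_empty) measurable
      also have "\<dots> \<le> 1" by (simp add: indicator_def)
      finally show ?thesis .
    qed
    moreover have "orthonormal_basis {} H" using True by (simp add: orthonormal_basis_def)
    ultimately show ?thesis by (intro exI[of _ "{}"]) simp
  next
    case False
    obtain w where w: "w \<in> H" "norm w = 1" "\<And>x. x \<in> H \<Longrightarrow> norm x * h w \<le> h x"
      by (rule attains_min_on_sphere[OF less.prems False]) (rule that)
    have ww: "w \<bullet> w = 1" using w(2) by (simp add: dot_square_norm)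
    have hw: "h w > 0" using w by (intro pos) auto
    define H' where "H' = H \<inter> orthogonal_comp {w}"
    have H': "subspace H'" unfolding H'_def using less.prems by (intro subspace_inter subspace_orthogonal_comp)
    have orthw: "x \<bullet> w = 0" if "x \<in> H'" for x
      using that by (auto simp: H'_def orthogonal_comp_def orthogonal_def inner_commute)
    have "w \<notin> H'" using orthw ww by force
    then have "span H' \<subset> span H"
      using w(1) H' less.prems by (auto simp: span_eq_iff[THEN iffD2] H'_def)
    then have "dim H' < dim H" by (rule dim_psubset)
    from less.hyps[OF this H'] obtain W where W: "orthonormal_basis W H'"
      and le: "\<And>r. r \<ge> 0 \<Longrightarrow> emeasure (coord_measure W) {x. h x \<le> r} \<le> ennreal (\<Prod>w\<in>W. 2 * r / h w)"
      by blast
    note ob = orthonormal_basisD[OF W]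
    have WH: "x \<in> H'" if "x \<in> W" for x using that ob(3) span_base by blast
    have wW: "w \<notin> W" using \<open>w \<notin> H'\<close> WH by blast
    have "orthonormal_basis (insert w W) H"
      unfolding orthonormal_basis_def
    proof (intro conjI)
      have "orthogonal w x" if "x \<in> W" for x
        using orthw[OF WH[OF that]] by (simp add: orthogonal_def inner_commute)
      then show "pairwise orthogonal (insert w W)"
        using W by (auto simp: orthonormal_basis_def pairwise_insert orthogonal_commute)
      show "\<forall>b\<in>insert w W. norm b = 1" using W w(2) by (simp add: orthonormal_basis_def)
      show "span (insert w W) = H"
      proof (rule span_subspace[OF _ _ less.prems])
        show "insert w W \<subseteq> H" using w(1) WH by (auto simp: H'_def)
        show "H \<subseteq> span (insert w W)"
        proof
          fix x assume x: "x \<in> H"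
          have "x - (x \<bullet> w) *\<^sub>R w \<in> H'"
            unfolding H'_def orthogonal_comp_def orthogonal_def
            using x w(1) less.prems ww by (auto simp: subspace_diff subspace_scale inner_diff_right inner_commute)
          then have "x - (x \<bullet> w) *\<^sub>R w \<in> span W" using ob(3) by simp
          then show "x \<in> span (insert w W)" unfolding span_insert by blast
        qed
      qed
    qed
    moreover have "emeasure (coord_measure (insert w W)) {x. h x \<le> r} \<le> ennreal (\<Prod>u\<in>insert w W. 2 * r / h u)"
      if r: "r \<ge> 0" for r
    proof -
      define \<rho> where "\<rho> = r / h w"
      have rho: "\<rho> \<ge> 0" using r hw by (simp add: \<rho>_def)
      have "emeasure (coord_measure (insert w W)) {x. h x \<le> r} = (\<integral>\<^sup>+x. indicator {x. h x \<le> r} x \<partial>coord_measure (insert w W))"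
        by (subst nn_integral_indicator) auto
      also have "\<dots> = (\<integral>\<^sup>+y. (\<integral>\<^sup>+s. indicator {x. h x \<le> r} (y + s *\<^sub>R w) \<partial>lborel) \<partial>coord_measure W)"
        by (rule nn_integral_coord_measure_insert[OF ob(1) wW]) measurable
      also have "\<dots> \<le> (\<integral>\<^sup>+y. (\<integral>\<^sup>+s. indicator {-\<rho>..\<rho>} s * indicator {x. h x \<le> r} (y + s *\<^sub>R w) \<partial>lborel) \<partial>coord_measure W)"
      proof (rule nn_integral_mono_AE, use AE_coord_measure_span[OF ob(1)] in eventually_elim)
        fix y assume "y \<in> span W"
        then have y: "y \<in> H'" using ob(3) by simp
        have "\<bar>s\<bar> \<le> \<rho>" if "h (y + s *\<^sub>R w) \<le> r" for s
        proof -
          have x: "y + s *\<^sub>R w \<in> H" using y w(1) less.prems by (auto simp: H'_def subspace_add subspace_scale)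
          have "s = (y + s *\<^sub>R w) \<bullet> w" using orthw[OF y] ww by (simp add: inner_add_left)
          then have "\<bar>s\<bar> \<le> norm (y + s *\<^sub>R w)" using Cauchy_Schwarz_ineq2[of "y + s *\<^sub>R w" w] w(2) by simp
          then have "\<bar>s\<bar> * h w \<le> norm (y + s *\<^sub>R w) * h w" using hw by (intro mult_right_mono) auto
          also have "\<dots> \<le> r" using w(3)[OF x] that by linarith
          finally show ?thesis using hw by (simp add: \<rho>_def field_simps)
        qed
        then show "(\<integral>\<^sup>+s. indicator {x. h x \<le> r} (y + s *\<^sub>R w) \<partial>lborel)
            \<le> (\<integral>\<^sup>+s. indicator {-\<rho>..\<rho>} s * indicator {x. h x \<le> r} (y + s *\<^sub>R w) \<partial>lborel)"
          by (intro nn_integral_mono) (fastforce simp: indicator_def abs_le_iff)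
      qed
      also have "\<dots> = (\<integral>\<^sup>+s. (\<integral>\<^sup>+y. indicator {-\<rho>..\<rho>} s * indicator {x. h x \<le> r} (y + s *\<^sub>R w) \<partial>coord_measure W) \<partial>lborel)"
        by (rule nn_integral_coord_measure_swap[OF ob(1) lborel.sigma_finite_measure_axioms]) measurable
      also have "\<dots> \<le> (\<integral>\<^sup>+s. indicator {-\<rho>..\<rho>} s * emeasure (coord_measure W) {x. h x \<le> r} \<partial>lborel)"
      proof (rule nn_integral_mono)
        fix s :: real
        have "(\<integral>\<^sup>+y. indicator {-\<rho>..\<rho>} s * indicator {x. h x \<le> r} (y + s *\<^sub>R w) \<partial>coord_measure W)
          = indicator {-\<rho>..\<rho>} s * (\<integral>\<^sup>+y. indicator {y. h (y + s *\<^sub>R w) \<le> r} y \<partial>coord_measure W)"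
        proof -
          have "indicator {x. h x \<le> r} (y + s *\<^sub>R w) = (indicator {y. h (y + s *\<^sub>R w) \<le> r} y :: ennreal)" for y
            by (simp add: indicator_def)
          then show ?thesis by (subst nn_integral_cmult[symmetric]) auto
        qed
        also have "\<dots> = indicator {-\<rho>..\<rho>} s * emeasure (coord_measure W) {y. h (y + s *\<^sub>R w) \<le> r}"
          by (subst nn_integral_indicator) auto
        also have "\<dots> \<le> indicator {-\<rho>..\<rho>} s * emeasure (coord_measure W) {x. h x \<le> r}"
          by (intro mult_left_mono central_section_maximal[OF W]) simp
        finally show "(\<integral>\<^sup>+y. indicator {-\<rho>..\<rho>} s * indicator {x. h x \<le> r} (y + s *\<^sub>R w) \<partial>coord_measure W)
          \<le> indicator {-\<rho>..\<rho>} s * emeasure (coord_measure W) {x. h x \<le> r}" .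
      qed
      also have "\<dots> = ennreal (2 * \<rho>) * emeasure (coord_measure W) {x. h x \<le> r}"
        using rho by (subst nn_integral_multc) auto
      also have "\<dots> \<le> ennreal (2 * \<rho>) * ennreal (\<Prod>u\<in>W. 2 * r / h u)"
        using r by (intro mult_left_mono le) auto
      also have "\<dots> = ennreal (\<Prod>u\<in>insert w W. 2 * r / h u)"
        using rho ob(1) wW by (simp add: ennreal_mult'[symmetric] \<rho>_def)
      finally show ?thesis .
    qed
    ultimately show ?thesis by blast
  qed
qed

end

section \<open>Integrating the covariogram over a subspace\<close>

text \<open>
  Induction on \<^term>\<open>d\<close> by integrating by parts, which trades one factor $s$ for one factor $1 - s$.
\<close>

lemma Beta_integral_binomial:
  assumes "0 < n"
  shows "((\<lambda>s::real. real n * (1 - s) ^ (n - 1) * s ^ d) has_integral 1 / real ((n + d) choose n)) {0..1}"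
  using assms
proof (induction d arbitrary: n)
  case 0
  have "((\<lambda>s::real. real n * (1 - s) ^ (n - 1) * s ^ 0) has_integral (- ((1 - 1) ^ n) - (- ((1 - 0) ^ n)))) {0..1}"
    by (rule fundamental_theorem_of_calculus)
       (auto intro!: derivative_eq_intros simp flip: has_real_derivative_iff_has_vector_derivative)
  then show ?case using 0 by (simp add: power_0_left)
next
  case (Suc d)
  let ?f = "\<lambda>s::real. (1 - s) ^ n * s ^ Suc d"
  have "((\<lambda>s::real. real (Suc d) * (1 - s) ^ n * s ^ d - real n * (1 - s) ^ (n - 1) * s ^ Suc d)
      has_integral (?f 1 - ?f 0)) {0..1}"
  proof (rule fundamental_theorem_of_calculus)
    fix s :: real
    have "(?f has_real_derivative real (Suc d) * (1 - s) ^ n * s ^ d - real n * (1 - s) ^ (n - 1) * s ^ Suc d) (at s within {0..1})"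
      by (rule derivative_eq_intros refl)+ simp
    then show "(?f has_vector_derivative real (Suc d) * (1 - s) ^ n * s ^ d - real n * (1 - s) ^ (n - 1) * s ^ Suc d) (at s within {0..1})"
      by (simp only: has_real_derivative_iff_has_vector_derivative)
  qed simp
  then have 1: "((\<lambda>s::real. real (Suc d) * (1 - s) ^ n * s ^ d - real n * (1 - s) ^ (n - 1) * s ^ Suc d) has_integral 0) {0..1}"
    using Suc.prems by (simp add: power_0_left)
  have "((\<lambda>s::real. real (Suc n) * (1 - s) ^ n * s ^ d) has_integral 1 / real ((Suc n + d) choose Suc n)) {0..1}"
    using Suc.IH[of "Suc n"] by simp
  from has_integral_mult_right[OF this, of "real (Suc d) / real (Suc n)"]
  have 2: "((\<lambda>s::real. real (Suc d) * (1 - s) ^ n * s ^ d) has_integral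
      real (Suc d) / real (Suc n) * (1 / real ((Suc n + d) choose Suc n))) {0..1}"
    by (simp add: mult.assoc[symmetric] del: of_nat_Suc)
  have "real (Suc n) * real ((n + Suc d) choose Suc n) = real (Suc d) * real ((n + Suc d) choose n)"
  proof -
    have "Suc n * ((n + Suc d) choose Suc n) = Suc d * ((n + Suc d) choose n)"
      using Suc_times_binomial[of n "n + d"] binomial_absorb_comp[of "n + Suc d" n]
      by (simp del: binomial_Suc_Suc mult_Suc)
    then show ?thesis by (simp only: of_nat_mult[symmetric])
  qed
  then have "real (Suc d) / real (Suc n) * (1 / real ((Suc n + d) choose Suc n)) = 1 / real ((n + Suc d) choose n)"
    by (simp add: field_simps del: of_nat_Suc binomial_Suc_Suc)
  with has_integral_diff[OF 2 1] show ?case by simp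
qed

text \<open>
  The fundamental theorem of calculus on the interval from \<^term>\<open>t\<close> to $1$. In this form an integral of the
  truncated power of a norm becomes an average of volumes of balls.
\<close>

lemma truncated_power_layer_cake:
  fixes t :: real
  assumes n: "0 < n" and t: "0 \<le> t"
  shows "ennreal (max 0 (1 - t) ^ n)
    = (\<integral>\<^sup>+s. ennreal (real n * (1 - s) ^ (n - 1)) * indicator {0..1} s * indicator {t..} s \<partial>lborel)"
proof (cases "t \<le> 1")
  case True
  have "((\<lambda>s::real. real n * (1 - s) ^ (n - 1)) has_integral (- ((1 - 1) ^ n) - (- ((1 - t) ^ n)))) {t..1}"
    using True by (intro fundamental_theorem_of_calculus)
       (auto intro!: derivative_eq_intros simp flip: has_real_derivative_iff_has_vector_derivative)
  then have "((\<lambda>s::real. real n * (1 - s) ^ (n - 1)) has_integral (1 - t) ^ n) {t..1}"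
    using n by (simp add: power_0_left)
  then have "(\<integral>\<^sup>+s. ennreal (real n * (1 - s) ^ (n - 1)) * indicator {t..1} s \<partial>lborel) = ennreal ((1 - t) ^ n)"
    by (intro nn_integral_has_integral_lebesgue') auto
  also have "(\<integral>\<^sup>+s. ennreal (real n * (1 - s) ^ (n - 1)) * indicator {t..1} s \<partial>lborel)
     = (\<integral>\<^sup>+s. ennreal (real n * (1 - s) ^ (n - 1)) * indicator {0..1} s * indicator {t..} s \<partial>lborel)"
    using t by (intro nn_integral_cong) (auto simp: indicator_def)
  finally show ?thesis using True by simp
next
  case False
  have "(\<integral>\<^sup>+s. ennreal (real n * (1 - s) ^ (n - 1)) * indicator {0..1} s * indicator {t..} s \<partial>lborel)
      = (\<integral>\<^sup>+(s::real). 0 \<partial>lborel)"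
    using False by (intro nn_integral_cong) (auto simp: indicator_def)
  then show ?thesis using False n by (simp add: power_0_left)
qed

context norm_function
begin

lemma nonneg: "0 \<le> h x"
  using pos[of x] zero by (cases "x = 0") auto

lemma nn_integral_truncated_power_le:
  assumes W: "orthonormal_basis W H" and n: "0 < n" and c: "0 < c"
    and le: "\<And>r. r \<ge> 0 \<Longrightarrow> emeasure (coord_measure W) {x. h x \<le> r} \<le> ennreal (\<Prod>w\<in>W. 2 * r / h w)"
  shows "(\<integral>\<^sup>+x. ennreal (max 0 (1 - h x / c) ^ n) \<partial>coord_measure W)
     \<le> ennreal ((2 * c) ^ card W / (\<Prod>w\<in>W. h w) / real ((n + card W) choose n))"
proof -
  note ob = orthonormal_basisD[OF W]
  let ?d = "card W"
  define q where "q s = ennreal (real n * (1 - s) ^ (n - 1)) * indicator {0..1} s" for s :: real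
  have [measurable]: "q \<in> borel_measurable borel" unfolding q_def by measurable
  define A where "A = (2 * c) ^ ?d / (\<Prod>w\<in>W. h w)"
  have A: "A \<ge> 0" using c nonneg by (simp add: A_def prod_nonneg)
  have "(\<integral>\<^sup>+x. ennreal (max 0 (1 - h x / c) ^ n) \<partial>coord_measure W)
      = (\<integral>\<^sup>+x. (\<integral>\<^sup>+s. q s * indicator {h x / c ..} s \<partial>lborel) \<partial>coord_measure W)"
    unfolding q_def using n c nonneg by (intro nn_integral_cong truncated_power_layer_cake) auto
  also have "\<dots> = (\<integral>\<^sup>+s. (\<integral>\<^sup>+x. q s * indicator {h x / c ..} s \<partial>coord_measure W) \<partial>lborel)"
  proof (rule nn_integral_coord_measure_swap[OF ob(1) lborel.sigma_finite_measure_axioms])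
    have [measurable]: "Measurable.pred (borel \<Otimes>\<^sub>M borel) (\<lambda>z. h (fst z) / c \<le> (snd z :: real))" by measurable
    have "(\<lambda>z. q (snd z) * indicator {z. h (fst z) / c \<le> snd z} z) \<in> borel_measurable (borel \<Otimes>\<^sub>M borel)"
      by measurable
    also have "(\<lambda>z. q (snd z) * indicator {z. h (fst z) / c \<le> snd z} z) = (\<lambda>(x, s). q s * indicator {h x / c ..} s)"
      by (auto simp: fun_eq_iff indicator_def)
    finally show "(\<lambda>(x, s). q s * indicator {h x / c ..} s) \<in> borel_measurable (borel \<Otimes>\<^sub>M lborel)"
      by (simp cong: measurable_cong_sets)
  qed
  also have "\<dots> \<le> (\<integral>\<^sup>+s. ennreal A * (ennreal (real n * (1 - s) ^ (n - 1) * s ^ ?d) * indicator {0..1} s) \<partial>lborel)"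
  proof (rule nn_integral_mono)
    fix s :: real
    show "(\<integral>\<^sup>+x. q s * indicator {h x / c ..} s \<partial>coord_measure W)
      \<le> ennreal A * (ennreal (real n * (1 - s) ^ (n - 1) * s ^ ?d) * indicator {0..1} s)"
    proof (cases "s \<in> {0..1}")
      case True
      have "(\<integral>\<^sup>+x. q s * indicator {h x / c ..} s \<partial>coord_measure W)
         = (\<integral>\<^sup>+x. q s * indicator {x. h x \<le> c * s} x \<partial>coord_measure W)"
        using c by (intro nn_integral_cong) (auto simp: indicator_def field_simps)
      also have "\<dots> = q s * emeasure (coord_measure W) {x. h x \<le> c * s}"
        by (subst nn_integral_cmult) auto
      also have "\<dots> \<le> q s * ennreal (\<Prod>w\<in>W. 2 * (c * s) / h w)"
        using c True by (intro mult_left_mono le) auto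
      also have "(\<Prod>w\<in>W. 2 * (c * s) / h w) = A * s ^ ?d"
        by (simp add: A_def prod_dividef power_mult_distrib)
      also have "q s * ennreal (A * s ^ ?d) = ennreal A * (ennreal (real n * (1 - s) ^ (n - 1) * s ^ ?d) * indicator {0..1} s)"
        using True A by (simp add: q_def ennreal_mult'[symmetric] mult_ac)
      finally show ?thesis .
    qed (simp add: q_def)
  qed
  also have "\<dots> = ennreal A * (\<integral>\<^sup>+s. ennreal (real n * (1 - s) ^ (n - 1) * s ^ ?d) * indicator {0..1} s \<partial>lborel)"
    by (rule nn_integral_cmult) measurable
  also have "(\<integral>\<^sup>+s. ennreal (real n * (1 - s) ^ (n - 1) * s ^ ?d) * indicator {0..1} s \<partial>lborel)
      = ennreal (1 / real ((n + ?d) choose n))"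
    by (intro nn_integral_has_integral_lebesgue' Beta_integral_binomial n) auto
  also have "ennreal A * ennreal (1 / real ((n + ?d) choose n)) = ennreal (A / real ((n + ?d) choose n))"
    using A by (simp add: ennreal_mult'[symmetric])
  finally show ?thesis by (simp add: A_def)
qed

end

lemma covariogram_eq_nn_integral:
  fixes K :: "'a::euclidean_space set"
  assumes K: "compact K"
  shows "ennreal (covariogram K x) = (\<integral>\<^sup>+u. indicator K u * indicator K (u - x) \<partial>lborel)"
proof -
  have c: "compact {y\<in>K. y - x \<in> K}" by (intro compact_Int_translate K)
  have "ennreal (covariogram K x) = emeasure lborel {y\<in>K. y - x \<in> K}"
    unfolding covariogram_def using compact_fmeasurable[OF c]
    by (subst emeasure_eq_measure2) (auto simp: fmeasurable_def)
  also have "\<dots> = (\<integral>\<^sup>+u. indicator {y\<in>K. y - x \<in> K} u \<partial>lborel)"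
    using borel_compact[OF c] by simp
  also have "\<dots> = (\<integral>\<^sup>+u. indicator K u * indicator K (u - x) \<partial>lborel)"
    by (intro nn_integral_cong) (auto simp: indicator_def)
  finally show ?thesis .
qed

text \<open>
  With $F(y)$ the volume of the section of \<^term>\<open>K\<close> through $y$ parallel to \<^term>\<open>H\<close>, the volume of \<^term>\<open>K\<close> is the
  integral of $F$ over the projection, and the covariogram integrates over \<^term>\<open>H\<close> to the integral of $F^2$.
\<close>

lemma measure_squared_le_projection_covariogram:
  fixes K :: "'a::euclidean_space set"
  assumes K: "compact K" and W: "orthonormal_basis W H" and B: "orthonormal_basis B (orthogonal_comp H)"
  shows "(emeasure lborel K)\<^sup>2 \<le> emeasure (coord_measure B) (orth_proj (orthogonal_comp H) ` K)
     * (\<integral>\<^sup>+x. ennreal (covariogram K x) \<partial>coord_measure W)"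
proof -
  let ?E = "orthogonal_comp H"
  note w = orthonormal_basisD[OF W] and b = orthonormal_basisD[OF B]
  have H: "subspace H" unfolding w(3)[symmetric] by (rule subspace_span)
  have E: "subspace ?E" by (rule subspace_orthogonal_comp)
  have EH: "orthogonal_comp ?E = H" by (rule orthogonal_comp_self[OF H])
  have W': "orthonormal_basis W (orthogonal_comp ?E)" unfolding EH by (rule W)
  have [measurable]: "K \<in> sets borel" using K by (rule borel_compact)
  have P[measurable]: "orth_proj ?E ` K \<in> sets borel" using compact_orth_proj[OF E K] by (rule borel_compact)
  define F where "F y = (\<integral>\<^sup>+z. indicator K (y + z) \<partial>coord_measure W)" for y
  have F[measurable]: "F \<in> borel_measurable borel"
    unfolding F_def by (rule nn_integral_coord_measure_measurable[OF w(1)]) measurable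
  have "emeasure lborel K = (\<integral>\<^sup>+u. indicator K u \<partial>lborel)" by simp
  also have "\<dots> = (\<integral>\<^sup>+y. F y \<partial>coord_measure B)"
    unfolding F_def by (rule nn_integral_lborel_orthonormal_split(1)[OF B W']) measurable
  also have "\<dots> = (\<integral>\<^sup>+y. indicator (orth_proj ?E ` K) y * F y \<partial>coord_measure B)"
  proof (rule nn_integral_cong_AE, use AE_coord_measure_span[OF b(1)] in eventually_elim)
    fix y assume "y \<in> span B"
    then have y: "y \<in> ?E" using b(3) by simp
    have "F y = 0" if "y \<notin> orth_proj ?E ` K"
    proof -
      have "F y = (\<integral>\<^sup>+z. 0 \<partial>coord_measure W)"
        unfolding F_def
      proof (rule nn_integral_cong_AE, use AE_coord_measure_span[OF w(1)] in eventually_elim)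
        fix z assume "z \<in> span W"
        then have "orth_proj ?E (y + z) = y" using w(3) EH by (intro orth_proj_add[OF E y]) simp
        then have "y + z \<notin> K" using that by (metis image_eqI)
        then show "indicator K (y + z) = (0::ennreal)" by simp
      qed
      then show ?thesis by simp
    qed
    then show "F y = indicator (orth_proj ?E ` K) y * F y" by (auto simp: indicator_def)
  qed
  finally have "(emeasure lborel K)\<^sup>2 = (\<integral>\<^sup>+y. indicator (orth_proj ?E ` K) y * F y \<partial>coord_measure B)\<^sup>2" by simp
  also have "\<dots> \<le> (\<integral>\<^sup>+y. (indicator (orth_proj ?E ` K) y)\<^sup>2 \<partial>coord_measure B) * (\<integral>\<^sup>+y. (F y)\<^sup>2 \<partial>coord_measure B)"
    by (rule Cauchy_Schwarz_nn_integral) measurable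
  also have "(\<integral>\<^sup>+y. (indicator (orth_proj ?E ` K) y)\<^sup>2 \<partial>coord_measure B) = emeasure (coord_measure B) (orth_proj ?E ` K)"
  proof -
    have "(indicator (orth_proj ?E ` K) y)\<^sup>2 = (indicator (orth_proj ?E ` K) y :: ennreal)" for y
      by (simp add: indicator_def)
    then show ?thesis by simp
  qed
  also have "(\<integral>\<^sup>+y. (F y)\<^sup>2 \<partial>coord_measure B) = (\<integral>\<^sup>+x. ennreal (covariogram K x) \<partial>coord_measure W)"
  proof -
    have "(\<integral>\<^sup>+x. ennreal (covariogram K x) \<partial>coord_measure W)
        = (\<integral>\<^sup>+x. (\<integral>\<^sup>+u. indicator K u * indicator K (u - x) \<partial>lborel) \<partial>coord_measure W)"
      by (simp only: covariogram_eq_nn_integral[OF K])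
    also have "\<dots> = (\<integral>\<^sup>+u. (\<integral>\<^sup>+x. indicator K u * indicator K (u - x) \<partial>coord_measure W) \<partial>lborel)"
      by (rule nn_integral_coord_measure_swap[OF w(1) lborel.sigma_finite_measure_axioms]) measurable
    also have "\<dots> = (\<integral>\<^sup>+u. indicator K u * (\<integral>\<^sup>+x. indicator K (u - x) \<partial>coord_measure W) \<partial>lborel)"
      by (rule nn_integral_cong, rule nn_integral_cmult) measurable
    also have "\<dots> = (\<integral>\<^sup>+y. (\<integral>\<^sup>+z. indicator K (y + z) * (\<integral>\<^sup>+x. indicator K (y + z - x) \<partial>coord_measure W) \<partial>coord_measure W) \<partial>coord_measure B)"
    proof (rule nn_integral_lborel_orthonormal_split(1)[OF B W'])
      have [measurable]: "(\<lambda>u. \<integral>\<^sup>+x. indicator K (u - x) \<partial>coord_measure W) \<in> borel_measurable borel"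
        by (rule nn_integral_coord_measure_measurable[OF w(1)]) measurable
      show "(\<lambda>u. indicator K u * (\<integral>\<^sup>+x. indicator K (u - x) \<partial>coord_measure W)) \<in> borel_measurable borel"
        by measurable
    qed
    also have "\<dots> = (\<integral>\<^sup>+y. (F y)\<^sup>2 \<partial>coord_measure B)"
    proof (rule nn_integral_cong)
      fix y
      have "(\<integral>\<^sup>+z. indicator K (y + z) * (\<integral>\<^sup>+x. indicator K (y + z - x) \<partial>coord_measure W) \<partial>coord_measure W)
         = (\<integral>\<^sup>+z. indicator K (y + z) * F y \<partial>coord_measure W)"
      proof (rule nn_integral_cong_AE, use AE_coord_measure_span[OF w(1)] in eventually_elim)
        fix z assume z: "z \<in> span W"
        have "(\<integral>\<^sup>+x. indicator K (y + (z - x)) \<partial>coord_measure W) = F y"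
          unfolding F_def by (rule nn_integral_coord_measure_reflect[OF w(1) z]) measurable
        then show "indicator K (y + z) * (\<integral>\<^sup>+x. indicator K (y + z - x) \<partial>coord_measure W) = indicator K (y + z) * F y"
          by (simp add: add_diff_eq)
      qed
      also have "\<dots> = F y * F y"
        unfolding F_def by (rule nn_integral_multc) measurable
      finally show "(\<integral>\<^sup>+z. indicator K (y + z) * (\<integral>\<^sup>+x. indicator K (y + z - x) \<partial>coord_measure W) \<partial>coord_measure W) = (F y)\<^sup>2"
        by (simp add: power2_eq_square)
    qed
    finally show ?thesis by simp
  qed
  finally show ?thesis .
qed

text \<open>
  The two estimates for the integral of the covariogram over \<^term>\<open>H\<close> are combined; on unit vectors the
  projection norm is the volume of the projection.
\<close>

theorem reverse_local_Loomis_Whitney: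
  fixes K H :: "'a::euclidean_space set"
  assumes K: "compact K" "convex K" "interior K \<noteq> {}" and H: "subspace H" "1 \<le> dim H"
  shows "\<exists>W. orthonormal_basis W H \<and>
    real ((DIM('a) + dim H) choose DIM('a)) / (2 * real DIM('a)) ^ dim H * (\<Prod>w\<in>W. proj_volume K w)
      \<le> measure (lebesgue_subspace (orthogonal_comp H)) (orth_proj (orthogonal_comp H) ` K)
         * measure lborel K ^ (dim H - 1)"
proof -
  let ?E = "orthogonal_comp H" and ?n = "DIM('a)" and ?h = "proj_norm K"
  interpret norm_function ?h
    by unfold_locales (fact proj_norm_triangle[OF K], fact proj_norm_scaleR, fact proj_norm_pos[OF K])
  obtain W where W: "orthonormal_basis W H"
    and le: "\<And>r. r \<ge> 0 \<Longrightarrow> emeasure (coord_measure W) {x. ?h x \<le> r} \<le> ennreal (\<Prod>w\<in>W. 2 * r / ?h w)"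
    using exists_basis_sublevel_le_box[OF H(1)] by blast
  note w = orthonormal_basisD[OF W]
  define d where "d = dim H"
  have d: "card W = d" "d \<ge> 1" using w(4) H(2) by (auto simp: d_def)
  define P where "P = measure (lebesgue_subspace ?E) (orth_proj ?E ` K)"
  obtain B where B: "orthonormal_basis B ?E" and PB: "ennreal P = emeasure (coord_measure B) (orth_proj ?E ` K)"
    unfolding P_def by (rule measure_lebesgue_subspace_proj[OF subspace_orthogonal_comp K(1)])
  have P0: "P \<ge> 0" by (simp add: P_def)
  define V where "V = measure lborel K"
  have V: "V > 0" unfolding V_def by (rule convex_body_measure_pos[OF K(1,3)])
  have eV: "emeasure lborel K = ennreal V"
    unfolding V_def using compact_fmeasurable[OF K(1)] by (intro emeasure_eq_measure2) (auto simp: fmeasurable_def)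
  define c where "c = real ?n * V"
  have c: "c > 0" using V by (simp add: c_def)
  define Q where "Q = (\<Prod>w\<in>W. ?h w)"
  have nz: "x \<noteq> 0" if "x \<in> W" for x using w(5)[OF that that] by auto
  have Q: "Q > 0" unfolding Q_def using nz by (intro prod_pos ballI pos)
  define b where "b = real ((?n + d) choose ?n)"
  have b: "b > 0" by (simp add: b_def)
  have "(\<integral>\<^sup>+x. ennreal (covariogram K x) \<partial>coord_measure W)
      \<le> (\<integral>\<^sup>+x. ennreal V * ennreal (max 0 (1 - ?h x / c) ^ ?n) \<partial>coord_measure W)"
    using covariogram_le[OF K] V
    by (intro nn_integral_mono) (simp add: V_def c_def ennreal_mult'[symmetric] ennreal_leI)
  also have "\<dots> = ennreal V * (\<integral>\<^sup>+x. ennreal (max 0 (1 - ?h x / c) ^ ?n) \<partial>coord_measure W)"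
    by (rule nn_integral_cmult) measurable
  also have "\<dots> \<le> ennreal V * ennreal ((2 * c) ^ d / Q / b)"
    using nn_integral_truncated_power_le[OF W, of ?n c] DIM_positive[where 'a='a] c le
    unfolding d(1) Q_def b_def by (intro mult_left_mono) auto
  also have "\<dots> = ennreal (V * ((2 * c) ^ d / Q / b))" using V by (intro ennreal_mult'[symmetric]) simp
  finally have g: "(\<integral>\<^sup>+x. ennreal (covariogram K x) \<partial>coord_measure W) \<le> ennreal (V * ((2 * c) ^ d / Q / b))" .
  have "ennreal (V\<^sup>2) = (emeasure lborel K)\<^sup>2" using V by (simp add: eV ennreal_power)
  also have "\<dots> \<le> ennreal P * (\<integral>\<^sup>+x. ennreal (covariogram K x) \<partial>coord_measure W)"
    unfolding PB by (rule measure_squared_le_projection_covariogram[OF K(1) W B])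
  also have "\<dots> \<le> ennreal P * ennreal (V * ((2 * c) ^ d / Q / b))" using g by (intro mult_left_mono) auto
  also have "\<dots> = ennreal (P * (V * ((2 * c) ^ d / Q / b)))" by (rule ennreal_mult'[OF P0, symmetric])
  finally have "V\<^sup>2 \<le> P * (V * ((2 * c) ^ d / Q / b))"
    using P0 V c Q b by (subst (asm) ennreal_le_iff) auto
  then have "V\<^sup>2 * (Q * b) \<le> P * V * (2 * c) ^ d" using Q b by (simp add: field_simps)
  also have "(2 * c) ^ d = (2 * real ?n) ^ d * (V * V ^ (d - 1))"
    using d(2) by (simp add: c_def power_mult_distrib mult.assoc flip: power_Suc)
  also have "P * V * ((2 * real ?n) ^ d * (V * V ^ (d - 1))) = V\<^sup>2 * (P * V ^ (d - 1) * (2 * real ?n) ^ d)"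
    by (simp add: power2_eq_square)
  finally have "Q * b \<le> P * V ^ (d - 1) * (2 * real ?n) ^ d"
    using V by simp
  then have "b / (2 * real ?n) ^ d * Q \<le> P * V ^ (d - 1)" by (simp add: field_simps)
  moreover have "Q = (\<Prod>w\<in>W. proj_volume K w)"
    unfolding Q_def using W by (intro prod.cong) (auto simp: proj_norm_def orthonormal_basis_def)
  ultimately show ?thesis
    using W by (intro exI[of _ W]) (simp add: b_def d_def V_def P_def)
qed

theorem theorem1p3:
  fixes K H :: "(real ^ 'n) set" and d :: nat
  assumes "convex_body K"
    and "2 \<le> d" and "d \<le> CARD('n) - 1"
    and "subspace H" and "dim H = d"
  shows "\<exists>w :: nat \<Rightarrow> real ^ 'n.
    inj_on w {1..d} \<and> orthonormal_basis (w ` {1..d}) H \<and>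
    measure (lebesgue_subspace (orthogonal_comp H)) (orth_proj (orthogonal_comp H) ` K)
      * measure lebesgue K ^ (d - 1)
    \<ge> real ((CARD('n) + d) choose CARD('n)) / (2 * real CARD('n)) ^ d
      * (\<Prod>i = 1..d. measure (lebesgue_subspace (orthogonal_comp {w i}))
                       (orth_proj (orthogonal_comp {w i}) ` K))"
proof -
  have K: "compact K" "convex K" "interior K \<noteq> {}" using assms(1) by (auto simp: convex_body_def)
  have "1 \<le> dim H" using assms(2,5) by simp
  then obtain W where W: "orthonormal_basis W H"
    and ineq: "real ((CARD('n) + d) choose CARD('n)) / (2 * real CARD('n)) ^ d * (\<Prod>w\<in>W. proj_volume K w)
      \<le> measure (lebesgue_subspace (orthogonal_comp H)) (orth_proj (orthogonal_comp H) ` K)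
         * measure lborel K ^ (d - 1)"
    using reverse_local_Loomis_Whitney[OF K assms(4)] assms(5) by auto
  have "finite W" "card W = d" using orthonormal_basisD[OF W] assms(5) by auto
  then obtain w where w: "bij_betw w {1..d} W" using ex_bij_betw_nat_finite_1 by blast
  have "(\<Prod>u\<in>W. proj_volume K u) = (\<Prod>i = 1..d. proj_volume K (w i))"
    using prod.reindex_bij_betw[OF w, of "proj_volume K"] by simp
  moreover have "measure lebesgue K = measure lborel K"
    using borel_compact[OF K(1)] by simp
  ultimately show ?thesis
    using w W ineq by (intro exI[of _ w]) (auto simp: bij_betw_def proj_volume_def)
qed

end
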